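(* Consider the aggregative game with players $\mathcal N=\{1,\dots,N\}$, strategy sets $K_i\subset\mathbb R^n$ and cost functions $f_i$, with the maps $F_i$, $\phi$, the sets $K=\prod_iK_i$, $\bar K=\sum_iK_i$, and the asynchronous gossip algorithm with constant agent-specific stepsizes $\alpha_{k,i}=\alpha_i>0$, all as defined in the context. Assume: (1) each $K_i$ is nonempty, compact and convex; each $f_i(x_i,u)$ is continuously differentiable in $(x_i,u)$ over some open set containing $K_i\times\bar K$; and each function $x_i\mapsto f_i(x_i,\bar x)$, with $\bar x=x_i+\sum_{j\ne i}x_j$, is convex over $K_i$; (2) $\phi$ is strictly monotone over $K$ ($(\phi(x)-\phi(x'))^T(x-x')>0$ for all $x\ne x'$ in $K$) and, moreover, strongly monotone over $K$ with constant $\mu>0$: $(\phi(x)-\phi(y))^T(x-y)\ge\mu\|x-y\|^2$ for all $x,y\in K$; (3) each $F_i(x_i,u)$ is uniformly Lipschitz continuous in $u$ over $\bar K$ for every fixed $x_i\in K_i$: for some $\bar L_i>0$, $\|F_i(x_i,z_1)-F_i(x_i,z_2)\|\le\bar L_i\|z_1-z_2\|$ for all $x_i\in K_i$ and $z_1,z_2\in\bar K$; (4) each $F_i(x_i,u)$ is uniformly Lipschitz continuous in $x_i$ over $K_i$ for every fixed $u\in\bar K$: for some $L_i>0$, $\|F_i(x_i,u)-F_i(y_i,u)\|\le L_i\|x_i-y_i\|$ for all $u\in\bar K$ and $x_i,y_i\in K_i$; (5) the undirected graph $\mathcal G(\mathcal N,\mathcal E)$ is connected; (6) with $\alpha_{\max}=\max_i\alpha_i$,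 $\alpha_{\min}=\min_i\alpha_i$, $p_{\max}=\max_ip_i$, $p_{\min}=\min_ip_i$, $$0<1-2\mu p_{\min}\alpha_{\min}+2p_{\max}(\max_iL_i)(\alpha_{\max}-\alpha_{\min})<1.$$ Then the generated sequence $x^k=(x_1^k,\dots,x_N^k)$ satisfies $$\limsup_{k\to\infty}\mathbb E[\|x^k-x^*\|^2]\le\frac{p_{\max}\alpha_{\max}^2\left(2C^2N+BC\frac{\sqrt{2nN}}{1-\sqrt\lambda}\right)}{\mu p_{\min}\alpha_{\min}-p_{\max}(\max_iL_i)(\alpha_{\max}-\alpha_{\min})},$$ where $x^*$ is the unique solution of VI$(K,\phi)$ (the unique $x^*\in K$ with $(x-x^* )^T\phi(x^* )\ge0$ for all $x\in K$), $B=(\max_i\bar L_i)NM$ with $M\ge\max_{x_i,z_i\in K_i}\|x_i-z_i\|$ for all $i$, and $C$ and $\lambda$ are the constants described in the context.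
   Context: Game: given $\bar x_{-i}=\sum_{j\ne i}x_j$, player $i$ minimizes $f_i(x_i,x_i+\bar x_{-i})$ over $x_i\in K_i$. Notation: $\bar x=\sum_jx_j$; $\bar K=\sum_iK_i$ (Minkowski sum); $K=\prod_iK_i$; $F_i(x_i,\bar x)=\nabla_{x_i}f_i(x_i,\bar x)$ is the gradient with respect to $x_i$ of $x_i\mapsto f_i(x_i,x_i+\bar x_{-i})$, i.e. $F_i(x_i,u)=\nabla_1f_i(x_i,u)+\nabla_2f_i(x_i,u)$; $\phi(x)=(F_1(x_1,\bar x)^T,\dots,F_N(x_N,\bar x)^T)^T$. $\Pi_{K_i}$ is Euclidean projection onto $K_i$; $\|\cdot\|$ is the Euclidean norm. Gossip model: $\mathcal G(\mathcal N,\mathcal E)$ is a fixed undirected graph without self-loops on $N\ge2$ nodes, $\mathcal N_i=\{j:\{i,j\}\in\mathcal E\}$. At each discrete time $k$ an agent $I^k$ is chosen uniformly at random from $\mathcal N$ and, given $I^k=i$, contacts a neighbor $J^k=j\in\mathcal N_i$ with probability $p_{ij}>0$, $\sum_{j\in\mathcal N_i}p_{ij}=1$; the pairs $(I^k,J^k)$ are independent over $k$ and independent of the initial decisions. $p_i=\frac1N\big(1+\sum_{j\in\mathcal N_i}p_{ji}\big)$ is the probability that $i\in\{I^k,J^k\}$. Gossip algorithm: start from (random) $x_i^0\in K_i$, $v_i^0=x_i^0$. At time $k$, for $i\in\{I^k,J^k\}$, $$\hat v_i^k=\tfrac12(v^k_{I^k}+v^k_{J^k}),\quad x_i^{k+1}=\Pi_{K_i}[x_i^k-\alpha_iF_i(x_i^k,N\hat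 v_i^k)],\quad v_i^{k+1}=\hat v_i^k+x_i^{k+1}-x_i^k,$$ and for $i\notin\{I^k,J^k\}$: $\hat v_i^k=v_i^k$, $x_i^{k+1}=x_i^k$, $v_i^{k+1}=v_i^k$. Constants: let $y^k=\frac1N\sum_iv_i^k$. Under assumptions (1) and (3) (the mixing matrices being doubly stochastic) the paper shows that there exists a constant $C$ such that $\|F_i(x_i^k,Ny^k)\|\le C$ and $\|F_i(x_i^k,N\hat v_i^k)\|\le C$ for all $i$ and $k\ge0$; $C$ is this constant. With $W(k)=\mathbb I-\frac12(e_{I^k}-e_{J^k})(e_{I^k}-e_{J^k})^T$ ($e_i$ the standard basis vectors of $\mathbb R^N$) and $D(k)=W(k)-\frac1N\mathbf 1\mathbf 1^T$ ($\mathbf 1$ the all-ones vector), there exists $\lambda\in(0,1)$ such that $\mathbb E[\|D(k)z\|^2]\le\lambda\|z\|^2$ for all $z\in\mathbb R^N$; $\lambda$ is this scalar.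
   Formalization: The smoothness in (1) and the Lipschitz condition (3) are assumed for u in a set containing K̄ and all points N v̂_i^k visited by the algorithm, not only in K̄, since these points can leave K̄, where F_i, hence the algorithm and C, would otherwise be undefined. *)

theory Defs
  imports "HOL-Probability.Probability"
begin

definition gradient :: "('a::euclidean_space \<Rightarrow> real) \<Rightarrow> 'a \<Rightarrow> 'a" where
  "gradient h x = (THE g. GDERIV h x :> g)"

definition continuously_differentiable_on ::
    "('a::euclidean_space \<Rightarrow> real) \<Rightarrow> 'a set \<Rightarrow> bool" where
  "continuously_differentiable_on h S \<longleftrightarrow>
     (\<exists>h'. (\<forall>x\<in>S. GDERIV h x :> h' x) \<and> continuous_on S h')"

text \<open>The players are the elements of the finite type \<open>'i\<close>, so N is \<open>CARD('i)\<close>, and strategies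
  live in \<open>real^'n\<close>. A strategy profile has type \<open>(real^'n)^'i\<close>, whose library norm and inner
  product are the Euclidean ones on the stacked vector. In \<open>f i a u\<close> the argument \<open>a\<close> is the
  decision of player \<open>i\<close> and \<open>u\<close> is the aggregate, which includes \<open>a\<close>.\<close>

definition aggregate :: "(real^'n)^'i \<Rightarrow> real^'n" where
  "aggregate x = (\<Sum>i\<in>UNIV. x $ i)"

definition profiles :: "('i \<Rightarrow> (real^'n) set) \<Rightarrow> ((real^'n)^'i) set" where
  "profiles K = {x. \<forall>i. x $ i \<in> K i}"

text \<open>The Minkowski sum of the strategy sets.\<close>

definition Kbar :: "('i::finite \<Rightarrow> (real^'n) set) \<Rightarrow> (real^'n) set" where
  "Kbar K = aggregate ` profiles K"

text \<open>The gradient in the own decision of player \<open>i\<close>, the decisions of the others being fixed: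
  at own decision \<open>a\<close> and aggregate \<open>u\<close>, the others contribute \<open>u - a\<close>.\<close>

definition F :: "('i \<Rightarrow> real^'n \<Rightarrow> real^'n \<Rightarrow> real) \<Rightarrow> 'i \<Rightarrow> real^'n \<Rightarrow> real^'n \<Rightarrow> real^'n" where
  "F f i a u = gradient (\<lambda>z. f i z (z + (u - a))) a"

definition phi :: "('i \<Rightarrow> real^'n \<Rightarrow> real^'n \<Rightarrow> real) \<Rightarrow> (real^'n)^'i \<Rightarrow> (real^'n)^'i" where
  "phi f x = (\<chi> i. F f i (x $ i) (aggregate x))"

definition VI_solution :: "'a::real_inner set \<Rightarrow> ('a \<Rightarrow> 'a) \<Rightarrow> 'a \<Rightarrow> bool" where
  "VI_solution S G z \<longleftrightarrow> z \<in> S \<and> (\<forall>x\<in>S. (x - z) \<bullet> G z \<ge> 0)"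

definition simple_graph :: "'i set set \<Rightarrow> bool" where
  "simple_graph E \<longleftrightarrow> (\<forall>e\<in>E. card e = 2)"

definition neighbours :: "'i set set \<Rightarrow> 'i \<Rightarrow> 'i set" where
  "neighbours E i = {j. {i, j} \<in> E}"

definition connected_graph :: "'i set set \<Rightarrow> bool" where
  "connected_graph E \<longleftrightarrow> (\<forall>i j. (i, j) \<in> {(a, b). {a, b} \<in> E}\<^sup>*)"

definition update_prob :: "'i::finite set set \<Rightarrow> ('i \<Rightarrow> 'i \<Rightarrow> real) \<Rightarrow> 'i \<Rightarrow> real" where
  "update_prob E p i = (1 + (\<Sum>j\<in>neighbours E i. p j i)) / real CARD('i)"

text \<open>\<open>I k\<close> is the agent that wakes up at time \<open>k\<close> and \<open>J k\<close> is the neighbour it contacts;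
  \<open>X0\<close> is the profile of initial decisions. The last conjunct says that \<open>X0\<close> is independent of
  the whole sequence of pairs, in terms of the generated sigma-algebras because \<open>indep_var\<close> only
  covers two random variables of the same type; it includes the measurability of \<open>X0\<close>.\<close>

definition gossip_model ::
    "'w measure \<Rightarrow> 'i::finite set set \<Rightarrow> ('i \<Rightarrow> 'i \<Rightarrow> real) \<Rightarrow>
     (nat \<Rightarrow> 'w \<Rightarrow> 'i) \<Rightarrow> (nat \<Rightarrow> 'w \<Rightarrow> 'i) \<Rightarrow> ('w \<Rightarrow> (real^'n)^'i) \<Rightarrow> bool" where
  "gossip_model M E p I J X0 \<longleftrightarrow>
     prob_space M \<and>
     (\<forall>i. \<forall>j\<in>neighbours E i. p i j > 0) \<and>
     (\<forall>i. (\<Sum>j\<in>neighbours E i. p i j) = 1) \<and>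
     (\<forall>k. \<forall>\<omega>\<in>space M. J k \<omega> \<in> neighbours E (I k \<omega>)) \<and>
     (\<forall>k i. \<P>(\<omega> in M. I k \<omega> = i) = 1 / real CARD('i)) \<and>
     (\<forall>k i. \<forall>j\<in>neighbours E i. \<P>(\<omega> in M. J k \<omega> = j \<bar> I k \<omega> = i) = p i j) \<and>
     prob_space.indep_vars M (\<lambda>_. count_space UNIV) (\<lambda>k \<omega>. (I k \<omega>, J k \<omega>)) UNIV \<and>
     prob_space.indep_set M
       (sets (vimage_algebra (space M) X0 borel))
       (sets (vimage_algebra (space M) (\<lambda>\<omega> k. (I k \<omega>, J k \<omega>))
                (Pi\<^sub>M UNIV (\<lambda>_::nat. count_space UNIV))))"

definition vhat_step :: "'i \<Rightarrow> 'i \<Rightarrow> (real^'n)^'i \<Rightarrow> (real^'n)^'i" where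
  "vhat_step a b v = (\<chi> i. if i \<in> {a, b} then (1/2) *\<^sub>R (v $ a + v $ b) else v $ i)"

definition x_step ::
    "('i::finite \<Rightarrow> (real^'n) set) \<Rightarrow> ('i \<Rightarrow> real^'n \<Rightarrow> real^'n \<Rightarrow> real) \<Rightarrow> ('i \<Rightarrow> real) \<Rightarrow>
     'i \<Rightarrow> 'i \<Rightarrow> (real^'n)^'i \<Rightarrow> (real^'n)^'i \<Rightarrow> (real^'n)^'i" where
  "x_step K f \<alpha> a b x v = (\<chi> i. if i \<in> {a, b}
     then closest_point (K i)
            (x $ i - \<alpha> i *\<^sub>R F f i (x $ i) (real CARD('i) *\<^sub>R vhat_step a b v $ i))
     else x $ i)"

text \<open>The pair of the decisions and the estimates of the average, for a deterministic
  sequence of active pairs.\<close>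

primrec gossip_state ::
    "('i::finite \<Rightarrow> (real^'n) set) \<Rightarrow> ('i \<Rightarrow> real^'n \<Rightarrow> real^'n \<Rightarrow> real) \<Rightarrow> ('i \<Rightarrow> real) \<Rightarrow>
     (nat \<Rightarrow> 'i) \<Rightarrow> (nat \<Rightarrow> 'i) \<Rightarrow> (real^'n)^'i \<Rightarrow> nat \<Rightarrow> ((real^'n)^'i) \<times> ((real^'n)^'i)" where
  "gossip_state K f \<alpha> a b x0 0 = (x0, x0)"
| "gossip_state K f \<alpha> a b x0 (Suc k) =
     (let (x, v) = gossip_state K f \<alpha> a b x0 k;
          x' = x_step K f \<alpha> (a k) (b k) x v
      in (x', \<chi> i. if i \<in> {a k, b k} then vhat_step (a k) (b k) v $ i + x' $ i - x $ i
                   else v $ i))"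

definition x_seq ::
    "('i::finite \<Rightarrow> (real^'n) set) \<Rightarrow> ('i \<Rightarrow> real^'n \<Rightarrow> real^'n \<Rightarrow> real) \<Rightarrow> ('i \<Rightarrow> real) \<Rightarrow>
     (nat \<Rightarrow> 'w \<Rightarrow> 'i) \<Rightarrow> (nat \<Rightarrow> 'w \<Rightarrow> 'i) \<Rightarrow> ('w \<Rightarrow> (real^'n)^'i) \<Rightarrow>
     nat \<Rightarrow> 'w \<Rightarrow> (real^'n)^'i" where
  "x_seq K f \<alpha> I J X0 k \<omega> =
     fst (gossip_state K f \<alpha> (\<lambda>t. I t \<omega>) (\<lambda>t. J t \<omega>) (X0 \<omega>) k)"

definition v_seq ::
    "('i::finite \<Rightarrow> (real^'n) set) \<Rightarrow> ('i \<Rightarrow> real^'n \<Rightarrow> real^'n \<Rightarrow> real) \<Rightarrow> ('i \<Rightarrow> real) \<Rightarrow>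
     (nat \<Rightarrow> 'w \<Rightarrow> 'i) \<Rightarrow> (nat \<Rightarrow> 'w \<Rightarrow> 'i) \<Rightarrow> ('w \<Rightarrow> (real^'n)^'i) \<Rightarrow>
     nat \<Rightarrow> 'w \<Rightarrow> (real^'n)^'i" where
  "v_seq K f \<alpha> I J X0 k \<omega> =
     snd (gossip_state K f \<alpha> (\<lambda>t. I t \<omega>) (\<lambda>t. J t \<omega>) (X0 \<omega>) k)"

definition vhat_seq ::
    "('i::finite \<Rightarrow> (real^'n) set) \<Rightarrow> ('i \<Rightarrow> real^'n \<Rightarrow> real^'n \<Rightarrow> real) \<Rightarrow> ('i \<Rightarrow> real) \<Rightarrow>
     (nat \<Rightarrow> 'w \<Rightarrow> 'i) \<Rightarrow> (nat \<Rightarrow> 'w \<Rightarrow> 'i) \<Rightarrow> ('w \<Rightarrow> (real^'n)^'i) \<Rightarrow>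
     nat \<Rightarrow> 'w \<Rightarrow> (real^'n)^'i" where
  "vhat_seq K f \<alpha> I J X0 k \<omega> = vhat_step (I k \<omega>) (J k \<omega>) (v_seq K f \<alpha> I J X0 k \<omega>)"

definition y_seq ::
    "('i::finite \<Rightarrow> (real^'n) set) \<Rightarrow> ('i \<Rightarrow> real^'n \<Rightarrow> real^'n \<Rightarrow> real) \<Rightarrow> ('i \<Rightarrow> real) \<Rightarrow>
     (nat \<Rightarrow> 'w \<Rightarrow> 'i) \<Rightarrow> (nat \<Rightarrow> 'w \<Rightarrow> 'i) \<Rightarrow> ('w \<Rightarrow> (real^'n)^'i) \<Rightarrow>
     nat \<Rightarrow> 'w \<Rightarrow> real^'n" where
  "y_seq K f \<alpha> I J X0 k \<omega> =
     (1 / real CARD('i)) *\<^sub>R (\<Sum>i\<in>UNIV. v_seq K f \<alpha> I J X0 k \<omega> $ i)"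

definition outer_product :: "real^'i \<Rightarrow> real^'i \<Rightarrow> real^'i^'i" where
  "outer_product u w = (\<chi> r c. u $ r * w $ c)"

definition mixing_matrix :: "'i::finite \<Rightarrow> 'i \<Rightarrow> real^'i^'i" where
  "mixing_matrix a b =
     mat 1 - (1/2) *\<^sub>R outer_product (axis a 1 - axis b 1) (axis a 1 - axis b 1)"

definition disagreement_matrix :: "'i::finite \<Rightarrow> 'i \<Rightarrow> real^'i^'i" where
  "disagreement_matrix a b =
     mixing_matrix a b - (1 / real CARD('i)) *\<^sub>R outer_product 1 1"

end

theory Submission
  imports Defs
begin

text \<open>Idea. Let \<open>z\<close> be the solution of the variational inequality and weight the squared errors of
  the players by \<open>1 / (p\<^sub>i \<alpha>\<^sub>i)\<close>. The weights cancel the activation probabilities and the stepsizes,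
  so that the expected drift of \<open>V = \<Sum>\<^sub>i \<parallel>x\<^sub>i - z\<^sub>i\<parallel>\<^sup>2 / (p\<^sub>i \<alpha>\<^sub>i)\<close> is governed by the full inner product
  \<open>\<phi>(x) \<bullet> (x - z) \<ge> \<mu> \<parallel>x - z\<parallel>\<^sup>2\<close>, whose individual summands have no sign. The estimation error is
  weighted by \<open>1 / p\<^sub>i\<close>; splitting it by Young's inequality leaves the squared consensus error of the two
  active players, of conditional mean at most \<open>p_max \<parallel>v - y\<parallel>\<^sup>2\<close>, because averaging a pair does not
  increase its squared error. The mean of \<open>\<parallel>v - y\<parallel>\<^sup>2\<close> contracts by \<open>\<surd>\<lambda>\<close> up to a perturbation of size
  \<open>2 (\<alpha>_max C)\<^sup>2 / (1 - \<surd>\<lambda>)\<close>. The Young parameter is tuned to a target level \<open>T\<close> of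
  \<open>\<parallel>x - z\<parallel>\<^sup>2\<close>, and one may assume \<open>T < N M\<^sup>2\<close> since \<open>\<parallel>x - z\<parallel>\<^sup>2 \<le> N M\<^sup>2\<close> holds anyway.\<close>

section \<open>Variational inequalities and strategy profiles\<close>

lemma linear_recursion_eventually_less:
  fixes u :: "nat \<Rightarrow> real"
  assumes \<rho>: "0 \<le> \<rho>" "\<rho> < 1"
    and rec: "eventually (\<lambda>k. u (Suc k) \<le> \<rho> * u k + h) sequentially"
    and t: "h < (1 - \<rho>) * t"
  shows "eventually (\<lambda>k. u k < t) sequentially"
proof -
  define l where "l = h / (1 - \<rho>)"
  have l: "h = (1 - \<rho>) * l" "l < t"
    using \<rho> t by (auto simp: l_def field_simps)
  from rec obtain K where K: "\<And>k. k \<ge> K \<Longrightarrow> u (Suc k) \<le> \<rho> * u k + h"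
    by (auto simp: eventually_sequentially)
  have *: "u (K + j) - l \<le> \<rho> ^ j * (u K - l)" for j
  proof (induction j)
    case (Suc j)
    have "u (K + Suc j) - l \<le> \<rho> * (u (K + j) - l)"
      using K[of "K + j"] by (simp add: l algebra_simps)
    also have "\<dots> \<le> \<rho> * (\<rho> ^ j * (u K - l))"
      by (intro mult_left_mono Suc \<rho>)
    finally show ?case by (simp add: mult.assoc)
  qed simp
  have "(\<lambda>j. \<rho> ^ j * (u K - l)) \<longlonglongrightarrow> 0 * (u K - l)"
    by (intro tendsto_intros LIMSEQ_power_zero) (use \<rho> in auto)
  hence "eventually (\<lambda>j. \<rho> ^ j * (u K - l) < t - l) sequentially"
    by (rule order_tendstoD) (use l in auto)
  hence "eventually (\<lambda>j. u (j + K) < t) sequentially"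
  proof eventually_elim
    case (elim j)
    thus ?case using *[of j] by (simp add: add.commute)
  qed
  thus ?thesis using eventually_sequentially_seg[of "\<lambda>k. u k < t" K] by blast
qed

text \<open>Weighted Young inequality: the gap between the two sides is a squared norm divided by
  \<open>r * (1 - r)\<close>. The value \<open>r = sqrt lam\<close> splits the consensus error;
  \<open>r = 1/2\<close> gives convexity of the squared norm.\<close>

lemma norm_add_square_le:
  fixes a b :: "'a::real_inner"
  assumes "0 < r" "r < 1"
  shows "(norm (a + b))\<^sup>2 \<le> (norm a)\<^sup>2 / r + (norm b)\<^sup>2 / (1 - r)"
proof -
  have "0 \<le> (norm ((1 - r) *\<^sub>R a - r *\<^sub>R b))\<^sup>2 / (r * (1 - r))"
    using assms by simp
  also have "\<dots> = (norm a)\<^sup>2 / r + (norm b)\<^sup>2 / (1 - r) - (norm (a + b))\<^sup>2"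
    using assms
    by (simp add: power2_norm_eq_inner inner_diff inner_add inner_commute field_simps)
  finally show ?thesis by simp
qed

lemma norm_sq_vec:
  fixes x :: "'a::real_inner ^ 'i"
  shows "(norm x)\<^sup>2 = (\<Sum>i\<in>UNIV. (norm (x $ i))\<^sup>2)"
  by (simp add: power2_norm_eq_inner inner_vec_def)

lemma norm_sq_vec_real:
  fixes x :: "real ^ 'i"
  shows "(norm x)\<^sup>2 = (\<Sum>i\<in>UNIV. (x $ i)\<^sup>2)"
  by (simp add: norm_sq_vec)

text \<open>Brouwer's theorem gives a fixed point of the projected step \<open>x - G x\<close>, and
  the obtuse-angle property of the projection turns the fixed-point equation into the variational
  inequality.\<close>

lemma VI_solution_exists:
  fixes S :: "'a::euclidean_space set"
  assumes S: "compact S" "convex S" "S \<noteq> {}" and G: "continuous_on S G"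
  shows "\<exists>z. VI_solution S G z"
proof -
  have cl: "closed S" using S compact_imp_closed by blast
  let ?h = "\<lambda>x. closest_point S (x - G x)"
  have "continuous_on S ?h"
    by (intro continuous_on_compose2[OF continuous_on_closest_point[OF S(2) cl S(3), of UNIV]]
        continuous_intros G) auto
  moreover have "?h \<in> S \<rightarrow> S" using cl S by (auto intro!: closest_point_in_set)
  ultimately obtain z where z: "z \<in> S" "?h z = z" using brouwer[OF S] by blast
  have "(x - z) \<bullet> G z \<ge> 0" if "x \<in> S" for x
    using closest_point_dot[OF S(2) cl that, of "z - G z"] z by (simp add: inner_commute)
  with z show ?thesis unfolding VI_solution_def by blast
qed

lemma profiles_component: "x \<in> profiles K \<Longrightarrow> x $ i \<in> K i"
  by (simp add: profiles_def)

lemma compact_profiles: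
  fixes K :: "'i::finite \<Rightarrow> (real^'n) set"
  assumes "\<And>i. compact (K i)"
  shows "compact (profiles K)"
proof -
  have "closed (profiles K)"
  proof -
    have "profiles K = (\<Inter>i. (\<lambda>x. x $ i) -` K i)" by (auto simp: profiles_def)
    moreover have "closed ((\<lambda>x. x $ i) -` K i)" for i
      by (intro closed_vimage compact_imp_closed assms continuous_intros)
    ultimately show ?thesis by (simp add: closed_INT)
  qed
  moreover have "bounded (profiles K)"
  proof -
    have "\<exists>b. \<forall>x\<in>K i. norm x \<le> b" for i
      using assms[of i] compact_imp_bounded bounded_iff by blast
    then obtain b where b: "\<And>i x. x \<in> K i \<Longrightarrow> norm x \<le> b i" by metis
    have "norm x \<le> (\<Sum>i\<in>UNIV. b i)" if "x \<in> profiles K" for x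
      using that b unfolding norm_vec_def
      by (intro order_trans[OF L2_set_le_sum]) (auto intro!: sum_mono simp: profiles_def)
    thus ?thesis by (auto simp: bounded_iff)
  qed
  ultimately show ?thesis by (simp add: compact_eq_bounded_closed)
qed

lemma convex_profiles:
  assumes "\<And>i. convex (K i)"
  shows "convex (profiles K)"
  using assms by (auto simp: convex_def profiles_def)

lemma profiles_nonempty:
  assumes "\<And>i. K i \<noteq> {}"
  shows "profiles K \<noteq> {}"
proof -
  have "(\<chi> i. SOME a. a \<in> K i) \<in> profiles K"
    using assms by (auto simp: profiles_def some_in_eq)
  thus ?thesis by blast
qed

section \<open>Gradients and continuity of the game map\<close>

lemma gradient_eqI:
  assumes "GDERIV h x :> g"
  shows "gradient h x = g"
proof -
  have "g' = g" if "GDERIV h x :> g'" for g'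
  proof -
    have "(\<lambda>k. k \<bullet> g') = (\<lambda>k. k \<bullet> g)"
      using has_derivative_unique assms that unfolding gderiv_def by blast
    thus ?thesis by (metis inner_commute vector_eq_rdot)
  qed
  thus ?thesis unfolding gradient_def using assms by blast
qed

text \<open>The chain rule along \<open>(z, z + (u - a))\<close> identifies \<open>F\<close> with
  the sum of the two partial gradients, the components of the continuous \<open>h'\<close>.\<close>

lemma continuous_on_F:
  fixes f :: "'i \<Rightarrow> real^'n \<Rightarrow> real^'n \<Rightarrow> real"
  assumes "continuously_differentiable_on (\<lambda>(a, u). f i a u) S"
  shows "continuous_on S (\<lambda>(a, u). F f i a u)"
proof -
  from assms obtain h' where
    h': "\<And>q. q \<in> S \<Longrightarrow> GDERIV (\<lambda>(a, u). f i a u) q :> h' q" and c: "continuous_on S h'"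
    unfolding continuously_differentiable_on_def by blast
  have "F f i a u = fst (h' (a, u)) + snd (h' (a, u))" if "(a, u) \<in> S" for a u
    unfolding F_def
  proof (rule gradient_eqI)
    have d: "((\<lambda>(a, u). f i a u) has_derivative (\<lambda>k. k \<bullet> h' (a, u))) (at (a, a + (u - a)))"
      using h'[OF that] by (simp add: gderiv_def)
    have "((\<lambda>z. (z, z + (u - a))) has_derivative (\<lambda>k. (k, k))) (at a)"
      by (auto intro!: derivative_eq_intros)
    from has_derivative_compose[OF this d]
    show "GDERIV (\<lambda>z. f i z (z + (u - a))) a :> fst (h' (a, u)) + snd (h' (a, u))"
      by (simp add: gderiv_def inner_prod_def inner_add_right split: prod.splits)
  qed
  hence "continuous_on S (\<lambda>(a, u). F f i a u) \<longleftrightarrow>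
         continuous_on S (\<lambda>q. fst (h' q) + snd (h' q))"
    by (intro continuous_on_cong) auto
  thus ?thesis using c by (simp add: continuous_on_add continuous_on_fst continuous_on_snd)
qed

lemma continuous_on_phi:
  fixes f :: "'i::finite \<Rightarrow> real^'n \<Rightarrow> real^'n \<Rightarrow> real"
  assumes "\<And>i. continuous_on (K i \<times> U) (\<lambda>(a, u). F f i a u)" and "Kbar K \<subseteq> U"
  shows "continuous_on (profiles K) (phi f)"
  unfolding phi_def
proof (rule continuous_on_vec_lambda)
  fix i
  have "continuous_on (profiles K) (\<lambda>x. (x $ i, aggregate x))"
    unfolding aggregate_def by (intro continuous_intros)
  from continuous_on_compose2[OF assms(1) this, of i] assms(2)
  show "continuous_on (profiles K) (\<lambda>x. F f i (x $ i) (aggregate x))"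
    by (auto simp: profiles_def Kbar_def)
qed

section \<open>Averaging steps\<close>

text \<open>The consensus error: the orthogonal projection of \<open>v\<close> onto the profiles
  with zero aggregate.\<close>

definition deviation :: "(real^'n)^'i \<Rightarrow> (real^'n)^'i" where
  "deviation v = (\<chi> i. v $ i - (1 / real CARD('i)) *\<^sub>R aggregate v)"

lemma aggregate_add: "aggregate (v + w) = aggregate v + aggregate w"
  by (simp add: aggregate_def sum.distrib)

lemma aggregate_diff: "aggregate (v - w) = aggregate v - aggregate w"
  by (simp add: aggregate_def sum_subtractf)

lemma deviation_add: "deviation (v + w) = deviation v + deviation w"
  by (simp add: deviation_def vec_eq_iff aggregate_add algebra_simps)

lemma aggregate_deviation: "aggregate (deviation v :: (real^'n)^'i::finite) = 0"
  by (simp add: deviation_def aggregate_def sum_subtractf sum_constant_scaleR del: sum_constant)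

text \<open>Pythagoras: the deviation is orthogonal to every constant profile, in particular to the
  mean that is subtracted.\<close>

lemma norm_deviation_le:
  fixes v :: "(real^'n)^'i::finite"
  shows "norm (deviation v) \<le> norm v"
proof -
  let ?y = "(1 / real CARD('i)) *\<^sub>R aggregate v"
  have "v = deviation v + (\<chi> i. ?y)" by (simp add: deviation_def vec_eq_iff)
  moreover have "deviation v \<bullet> (\<chi> i. w) = aggregate (deviation v) \<bullet> w" for w
    by (simp add: inner_vec_def[of "deviation v"] aggregate_def inner_sum_left)
  hence "deviation v \<bullet> (\<chi> i. ?y) = 0" by (simp only: aggregate_deviation inner_zero_left)
  ultimately have "(norm v)\<^sup>2 = (norm (deviation v))\<^sup>2 + (norm (\<chi> i::'i. ?y))\<^sup>2"
    by (metis norm_add_Pythagorean orthogonal_def)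
  hence "(norm (deviation v))\<^sup>2 \<le> (norm v)\<^sup>2" by simp
  thus ?thesis by (simp add: norm_le_square)
qed

text \<open>Double stochasticity: two entries are replaced by their mean, which keeps their sum. For
  \<open>a = b\<close> the step is the identity and no pair can be split off the sum.\<close>

lemma aggregate_vhat_step:
  fixes v :: "(real^'n)^'i::finite"
  shows "aggregate (vhat_step a b v) = aggregate v"
proof (cases "a = b")
  case True
  have "vhat_step a b v = v" using True
    by (auto simp: vhat_step_def vec_eq_iff scaleR_2[symmetric])
  thus ?thesis by simp
next
  case False
  let ?m = "(1/2::real) *\<^sub>R (v $ a + v $ b)"
  have *: "sum h UNIV = h a + h b + sum h (UNIV - {a, b})" for h :: "'i \<Rightarrow> real^'n"
    using False by (subst sum.subset_diff[of "{a, b}"]) (auto simp: add.commute)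
  have "?m + ?m = v $ a + v $ b" by (simp add: scaleR_left.add[symmetric] scaleR_right_distrib)
  thus ?thesis unfolding aggregate_def
    by (subst (1 2) *) (auto simp: vhat_step_def intro!: sum.cong)
qed

lemma vhat_step_deviation:
  "vhat_step a b (deviation v) $ i =
   vhat_step a b v $ i - (1 / real CARD('i::finite)) *\<^sub>R aggregate (v :: (real^'n)^'i)"
proof -
  have *: "(1/2) *\<^sub>R ((x - z) + (y - z)) = (1/2) *\<^sub>R (x + y) - z" for x y z :: "real^'n"
    by (simp add: vec_eq_iff field_simps)
  show ?thesis
    unfolding vhat_step_def deviation_def by (simp only: vec_lambda_beta * split: if_split) simp
qed

text \<open>Averaging preserves the aggregate and commutes with shifts by a constant profile, hence
  commutes with removing the mean.\<close>

lemma deviation_vhat_step: "deviation (vhat_step a b v) = vhat_step a b (deviation v)"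
proof -
  have "deviation (vhat_step a b v) $ i = vhat_step a b (deviation v) $ i" for i
    unfolding vhat_step_deviation by (simp add: deviation_def aggregate_vhat_step)
  thus ?thesis by (simp add: vec_eq_iff)
qed

text \<open>Links the matrices behind \<open>lam\<close> to the averaging step. On a column of zero
  sum the all-ones term vanishes, and the rank-one correction moves half of the difference between
  the entries at \<open>a\<close> and \<open>b\<close>, making both equal to their mean.\<close>

lemma disagreement_matrix_vector_mult:
  fixes e :: "(real^'n)^'i::finite"
  assumes "aggregate e = 0"
  shows "disagreement_matrix a b *v (\<chi> i. e $ i $ c) = (\<chi> i. vhat_step a b e $ i $ c)"
proof -
  let ?z = "(\<chi> i. e $ i $ c) :: real^'i"
  have s: "(\<Sum>i\<in>UNIV. e $ i $ c) = 0"
    using arg_cong[OF assms, of "\<lambda>s. s $ c"] by (simp add: aggregate_def)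
  have op: "outer_product u w *v z = (w \<bullet> z) *\<^sub>R u" for u w z :: "real^'i"
    by (simp add: vec_eq_iff outer_product_def matrix_vector_mult_def inner_vec_def
        sum_distrib_left mult_ac)
  have one: "1 \<bullet> ?z = 0" using s by (simp add: inner_vec_def)
  have "disagreement_matrix a b *v ?z =
      ?z - ((1/2) * (?z $ a - ?z $ b)) *\<^sub>R (axis a 1 - axis b 1)"
    unfolding disagreement_matrix_def mixing_matrix_def
    by (simp add: matrix_vector_mult_diff_rdistrib scaleR_matrix_vector_assoc[symmetric] op one
        inner_diff_left inner_axis')
  also have "\<dots> = (\<chi> i. vhat_step a b e $ i $ c)"
    by (auto simp: vec_eq_iff vhat_step_def axis_def field_simps)
  finally show ?thesis .
qed

text \<open>Strategies are vectors while the bound for \<open>lam\<close> concerns real columns;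
  working one coordinate at a time makes the contraction factor independent of the
  dimension.\<close>

lemma norm_sq_vhat_step:
  fixes e :: "(real^'n)^'i::finite"
  assumes "aggregate e = 0"
  shows "(norm (vhat_step a b e))\<^sup>2 =
         (\<Sum>c\<in>UNIV. (norm (disagreement_matrix a b *v (\<chi> i. e $ i $ c)))\<^sup>2)"
proof -
  have "(norm (vhat_step a b e))\<^sup>2 = (\<Sum>i\<in>UNIV. \<Sum>c\<in>UNIV. (vhat_step a b e $ i $ c)\<^sup>2)"
    by (simp add: norm_sq_vec[of "vhat_step a b e"] norm_sq_vec_real)
  also have "\<dots> = (\<Sum>c\<in>UNIV. \<Sum>i\<in>UNIV. (vhat_step a b e $ i $ c)\<^sup>2)"
    by (rule sum.swap)
  finally show ?thesis
    unfolding disagreement_matrix_vector_mult[OF assms] by (simp add: norm_sq_vec_real)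
qed

lemma norm_sq_eq_sum_columns:
  fixes e :: "(real^'n)^'i"
  shows "(norm e)\<^sup>2 = (\<Sum>c\<in>UNIV. (norm (\<chi> i. e $ i $ c))\<^sup>2)"
  by (simp add: norm_sq_vec[of e] norm_sq_vec_real) (rule sum.swap)

text \<open>Convexity of the squared norm. The sum over the pair is unweighted, which is what makes
  this local bound valid; if \<open>a = b\<close> both sides agree.\<close>

lemma sum_active_vhat_step_le:
  fixes e :: "(real^'n)^'i::finite"
  shows "(\<Sum>i\<in>{a, b}. (norm (vhat_step a b e $ i))\<^sup>2) \<le> (\<Sum>i\<in>{a, b}. (norm (e $ i))\<^sup>2)"
proof -
  have "(norm ((1/2) *\<^sub>R (x + y)))\<^sup>2 \<le> ((norm x)\<^sup>2 + (norm y)\<^sup>2) / 2" for x y :: "real^'n"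
    using norm_add_square_le[of "1/2" x y] by (simp add: power_mult_distrib power2_eq_square)
  from this[of "e $ a" "e $ b"] show ?thesis
    by (cases "a = b") (auto simp: vhat_step_def scaleR_2[symmetric])
qed

section \<open>The random pairs and their past\<close>

lemma (in prob_space) indep_set_mono:
  assumes "indep_set A B" "A' \<subseteq> A" "B' \<subseteq> B"
  shows "indep_set A' B'"
  using assms unfolding indep_sets2_eq by blast

locale gossip_process = prob_space M
  for M :: "'w measure" +
  fixes E :: "'i::finite set set"
    and p :: "'i \<Rightarrow> 'i \<Rightarrow> real"
    and I J :: "nat \<Rightarrow> 'w \<Rightarrow> 'i"
    and X0 :: "'w \<Rightarrow> (real^'n)^'i"
  assumes graph: "simple_graph E"
    and gossip: "gossip_model M E p I J X0"
begin

lemma p_pos: "j \<in> neighbours E i \<Longrightarrow> p i j > 0"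
  and J_neighbour: "\<omega> \<in> space M \<Longrightarrow> J k \<omega> \<in> neighbours E (I k \<omega>)"
  and prob_I: "prob {\<omega> \<in> space M. I k \<omega> = i} = 1 / real CARD('i)"
  and cond_prob_J: "j \<in> neighbours E i \<Longrightarrow> \<P>(\<omega> in M. J k \<omega> = j \<bar> I k \<omega> = i) = p i j"
  and indep_pairs: "indep_vars (\<lambda>_. count_space UNIV) (\<lambda>k \<omega>. (I k \<omega>, J k \<omega>)) UNIV"
  and indep_init: "indep_set (sets (vimage_algebra (space M) X0 borel))
       (sets (vimage_algebra (space M) (\<lambda>\<omega> k. (I k \<omega>, J k \<omega>))
                (Pi\<^sub>M UNIV (\<lambda>_::nat. count_space UNIV))))"
  using gossip unfolding gossip_model_def by blast+

lemma neighbours_irrefl: "i \<notin> neighbours E i"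
  using graph by (force simp: neighbours_def simple_graph_def)

lemma neighbours_sym: "j \<in> neighbours E i \<longleftrightarrow> i \<in> neighbours E j"
  by (simp add: neighbours_def insert_commute)

lemma I_neq_J: "\<omega> \<in> space M \<Longrightarrow> I k \<omega> \<noteq> J k \<omega>"
  using J_neighbour neighbours_irrefl by metis

lemma measurable_pair [measurable]: "(\<lambda>\<omega>. (I k \<omega>, J k \<omega>)) \<in> measurable M (count_space UNIV)"
  using indep_pairs unfolding indep_vars_def by auto

lemma measurable_I [measurable]: "I k \<in> measurable M (count_space UNIV)"
  using measurable_compose[OF measurable_pair, of fst "count_space UNIV"] by simp

lemma measurable_J [measurable]: "J k \<in> measurable M (count_space UNIV)"
  using measurable_compose[OF measurable_pair, of snd "count_space UNIV"] by simp

section \<open>Activation probabilities\<close>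

lemma prob_pair:
  assumes "j \<in> neighbours E i"
  shows "prob {\<omega> \<in> space M. I k \<omega> = i \<and> J k \<omega> = j} = p i j / real CARD('i)"
  using cond_prob_J[OF assms, of k] prob_I[of k i]
  by (simp add: cond_prob_def conj_commute field_simps)

lemma update_prob_pos: "update_prob E p i > 0"
proof -
  have "(\<Sum>j\<in>neighbours E i. p j i) \<ge> 0"
    using p_pos neighbours_sym by (intro sum_nonneg) (auto intro: less_imp_le)
  thus ?thesis by (auto simp: update_prob_def intro!: divide_pos_pos)
qed

text \<open>Waking up and being contacted are disjoint events since the graph has no self-loops; the
  latter splits over the possible callers.\<close>

lemma prob_active: "prob {\<omega> \<in> space M. i = I k \<omega> \<or> i = J k \<omega>} = update_prob E p i"
proof -
  have "prob {\<omega> \<in> space M. J k \<omega> = i} =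
      prob (\<Union>j\<in>neighbours E i. {\<omega> \<in> space M. I k \<omega> = j \<and> J k \<omega> = i})"
    using J_neighbour neighbours_sym by (intro arg_cong[where f = prob]) blast
  also have "\<dots> = (\<Sum>j\<in>neighbours E i. prob {\<omega> \<in> space M. I k \<omega> = j \<and> J k \<omega> = i})"
    by (intro finite_measure_finite_Union) (auto simp: disjoint_family_on_def)
  also have "\<dots> = (\<Sum>j\<in>neighbours E i. p j i / real CARD('i))"
    using prob_pair neighbours_sym by (intro sum.cong) auto
  finally have J: "prob {\<omega> \<in> space M. J k \<omega> = i} = (\<Sum>j\<in>neighbours E i. p j i) / real CARD('i)"
    by (simp add: sum_divide_distrib)
  have "prob {\<omega> \<in> space M. i = I k \<omega> \<or> i = J k \<omega>} =
      prob ({\<omega> \<in> space M. I k \<omega> = i} \<union> {\<omega> \<in> space M. J k \<omega> = i})"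
    by (intro arg_cong[where f = prob]) blast
  also have "\<dots> = prob {\<omega> \<in> space M. I k \<omega> = i} + prob {\<omega> \<in> space M. J k \<omega> = i}"
    by (intro finite_measure_Union) (auto simp: disjoint_iff dest: I_neq_J[of _ k])
  finally show ?thesis
    by (simp add: prob_I J update_prob_def add_divide_distrib)
qed

text \<open>Rectangles fixing the initial decisions and the pairs strictly before time
  \<open>k\<close>. They form a generator closed under intersections, on which the product rule can
  be checked directly. The pair of time \<open>k\<close> itself is excluded, so that it is
  independent of the state at time \<open>k\<close>.\<close>

definition past_events :: "nat \<Rightarrow> 'w set set" where
  "past_events k = {X0 -` A \<inter> {\<omega> \<in> space M. \<forall>t<k. (I t \<omega>, J t \<omega>) \<in> B t} |A B. A \<in> sets borel}"

definition past :: "nat \<Rightarrow> 'w measure" where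
  "past k = sigma (space M) (past_events k)"

lemma past_events_subset: "past_events k \<subseteq> Pow (space M)"
  by (auto simp: past_events_def)

lemma space_past [simp]: "space (past k) = space M"
  using past_events_subset by (simp add: past_def space_measure_of_conv)

lemma sets_past: "sets (past k) = sigma_sets (space M) (past_events k)"
  using past_events_subset by (simp add: past_def)

lemma past_eventsI:
  "A \<in> sets borel \<Longrightarrow>
    X0 -` A \<inter> {\<omega> \<in> space M. \<forall>t<k. (I t \<omega>, J t \<omega>) \<in> B t} \<in> past_events k"
  unfolding past_events_def by blast

lemma past_eventsE:
  assumes "a \<in> past_events k"
  obtains A B where "A \<in> sets borel"
    "a = X0 -` A \<inter> {\<omega> \<in> space M. \<forall>t<k. (I t \<omega>, J t \<omega>) \<in> B t}"
  using assms unfolding past_events_def by blast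

lemma Int_stable_past_events: "Int_stable (past_events k)"
proof (rule Int_stableI)
  fix a b assume a: "a \<in> past_events k" and b: "b \<in> past_events k"
  obtain A B where A: "A \<in> sets borel"
    and a_eq: "a = X0 -` A \<inter> {\<omega> \<in> space M. \<forall>t<k. (I t \<omega>, J t \<omega>) \<in> B t}"
    using a by (rule past_eventsE)
  obtain A' B' where A': "A' \<in> sets borel"
    and b_eq: "b = X0 -` A' \<inter> {\<omega> \<in> space M. \<forall>t<k. (I t \<omega>, J t \<omega>) \<in> B' t}"
    using b by (rule past_eventsE)
  have "\<omega> \<in> a \<inter> b \<longleftrightarrow>
      \<omega> \<in> X0 -` (A \<inter> A') \<inter> {\<omega> \<in> space M. \<forall>t<k. (I t \<omega>, J t \<omega>) \<in> B t \<inter> B' t}" for \<omega>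
    unfolding a_eq b_eq Int_iff vimage_eq mem_Collect_eq by iprover
  hence "a \<inter> b = X0 -` (A \<inter> A') \<inter> {\<omega> \<in> space M. \<forall>t<k. (I t \<omega>, J t \<omega>) \<in> B t \<inter> B' t}"
    by (rule set_eqI)
  also have "\<dots> \<in> past_events k"
    by (rule past_eventsI) (rule sets.Int[OF A A'])
  finally show "a \<inter> b \<in> past_events k" .
qed

lemma prob_pairs:
  "prob {\<omega> \<in> space M. \<forall>t<k. (I t \<omega>, J t \<omega>) \<in> B t} =
   (\<Prod>t<k. prob {\<omega> \<in> space M. (I t \<omega>, J t \<omega>) \<in> B t})"
\<comment> \<open>The product rule for independent variables is applied over a nonempty index set;
  for \<open>k = 0\<close> the event is the whole space.\<close>
proof (cases "k = 0")
  case True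
  thus ?thesis by (simp add: prob_space)
next
  case False
  hence "prob {\<omega> \<in> space M. \<forall>t<k. (I t \<omega>, J t \<omega>) \<in> B t} =
      prob (\<Inter>t\<in>{..<k}. (\<lambda>\<omega>. (I t \<omega>, J t \<omega>)) -` B t \<inter> space M)"
    by (intro arg_cong[where f = prob]) auto
  also have "\<dots> = (\<Prod>t\<in>{..<k}. prob ((\<lambda>\<omega>. (I t \<omega>, J t \<omega>)) -` B t \<inter> space M))"
    using False by (intro indep_varsD[OF indep_pairs]) auto
  also have "\<dots> = (\<Prod>t<k. prob {\<omega> \<in> space M. (I t \<omega>, J t \<omega>) \<in> B t})"
    by (intro prod.cong refl arg_cong[where f = prob]) auto
  finally show ?thesis .
qed

text \<open>A condition on finitely many pairs is the preimage, under the whole sequence of pairs,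
  of a measurable set of the product space, so the assumed independence from \<open>X0\<close>
  covers it.\<close>

lemma indep_init_pairs:
  assumes "A \<in> sets borel"
  shows "X0 -` A \<inter> {\<omega> \<in> space M. \<forall>t<k. (I t \<omega>, J t \<omega>) \<in> B t} \<in> events"
    and "prob (X0 -` A \<inter> {\<omega> \<in> space M. \<forall>t<k. (I t \<omega>, J t \<omega>) \<in> B t}) =
         prob (X0 -` A \<inter> space M) * prob {\<omega> \<in> space M. \<forall>t<k. (I t \<omega>, J t \<omega>) \<in> B t}"
proof -
  let ?P = "{\<omega> \<in> space M. \<forall>t<k. (I t \<omega>, J t \<omega>) \<in> B t}"
  have a: "X0 -` A \<inter> space M \<in> sets (vimage_algebra (space M) X0 borel)"
    using assms by (rule in_vimage_algebra)
  have "{g \<in> space (Pi\<^sub>M UNIV (\<lambda>_::nat. count_space UNIV)). \<forall>t<k. g t \<in> B t}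
      \<in> sets (Pi\<^sub>M UNIV (\<lambda>_::nat. count_space (UNIV :: ('i \<times> 'i) set)))"
    by measurable
  from in_vimage_algebra[OF this, of "\<lambda>\<omega> k. (I k \<omega>, J k \<omega>)" "space M"]
  have "(\<lambda>\<omega> k. (I k \<omega>, J k \<omega>)) -`
      {g \<in> space (Pi\<^sub>M UNIV (\<lambda>_::nat. count_space UNIV)). \<forall>t<k. g t \<in> B t} \<inter> space M
      \<in> sets (vimage_algebra (space M) (\<lambda>\<omega> k. (I k \<omega>, J k \<omega>))
                (Pi\<^sub>M UNIV (\<lambda>_::nat. count_space UNIV)))" .
  also have "(\<lambda>\<omega> k. (I k \<omega>, J k \<omega>)) -`
      {g \<in> space (Pi\<^sub>M UNIV (\<lambda>_::nat. count_space UNIV)). \<forall>t<k. g t \<in> B t} \<inter> space M = ?P"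
    by (auto simp: space_PiM)
  finally
  have b: "?P \<in> sets (vimage_algebra (space M) (\<lambda>\<omega> k. (I k \<omega>, J k \<omega>))
                (Pi\<^sub>M UNIV (\<lambda>_::nat. count_space UNIV)))" .
  have eq: "X0 -` A \<inter> ?P = (X0 -` A \<inter> space M) \<inter> ?P" by blast
  have "X0 -` A \<inter> space M \<in> events" "?P \<in> events"
    by (rule subsetD[OF indep_setD_ev1[OF indep_init] a] subsetD[OF indep_setD_ev2[OF indep_init] b])+
  thus "X0 -` A \<inter> ?P \<in> events" unfolding eq by (rule sets.Int)
  show "prob (X0 -` A \<inter> ?P) = prob (X0 -` A \<inter> space M) * prob ?P"
    unfolding eq by (rule indep_setD[OF indep_init a b])
qed

lemma past_events_events: "past_events k \<subseteq> events"
proof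
  fix a assume "a \<in> past_events k"
  then obtain A B where "A \<in> sets borel"
    "a = X0 -` A \<inter> {\<omega> \<in> space M. \<forall>t<k. (I t \<omega>, J t \<omega>) \<in> B t}"
    by (rule past_eventsE)
  thus "a \<in> events" by (simp only: indep_init_pairs(1))
qed

lemma sets_past_subset: "sets (past k) \<subseteq> events"
  unfolding sets_past
  by (rule sets.sigma_sets_subset[OF past_events_events])

lemma measurable_past: "g \<in> measurable (past k) N \<Longrightarrow> g \<in> measurable M N"
  using sets_past_subset[of k] by (auto simp: measurable_def)

definition pair_events :: "nat \<Rightarrow> 'w set set" where
  "pair_events k = range (\<lambda>B. {\<omega> \<in> space M. (I k \<omega>, J k \<omega>) \<in> B})"

lemma pair_events_subset: "pair_events k \<subseteq> events"
proof
  fix b assume "b \<in> pair_events k"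
  then obtain B where "b = (\<lambda>\<omega>. (I k \<omega>, J k \<omega>)) -` B \<inter> space M"
    by (auto simp: pair_events_def)
  thus "b \<in> events" using measurable_sets[OF measurable_pair, of B k] by simp
qed

lemma Int_stable_pair_events: "Int_stable (pair_events k)"
proof (rule Int_stableI)
  fix a b assume "a \<in> pair_events k" "b \<in> pair_events k"
  then obtain B B' where "a = {\<omega> \<in> space M. (I k \<omega>, J k \<omega>) \<in> B}"
    "b = {\<omega> \<in> space M. (I k \<omega>, J k \<omega>) \<in> B'}" by (auto simp: pair_events_def)
  hence "a \<inter> b = {\<omega> \<in> space M. (I k \<omega>, J k \<omega>) \<in> B \<inter> B'}" by auto
  thus "a \<inter> b \<in> pair_events k" unfolding pair_events_def by (rule image_eqI) simp
qed

text \<open>Intersecting with an event of the current pair gives a rectangle of horizon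
  \<open>Suc k\<close>, and its product of probabilities has just one more factor.\<close>

lemma prob_past_pair:
  assumes "a \<in> past_events k"
  shows "prob (a \<inter> {\<omega> \<in> space M. (I k \<omega>, J k \<omega>) \<in> B'}) =
         prob a * prob {\<omega> \<in> space M. (I k \<omega>, J k \<omega>) \<in> B'}"
proof -
  from assms obtain A B where A: "A \<in> sets borel"
    and a: "a = X0 -` A \<inter> {\<omega> \<in> space M. \<forall>t<k. (I t \<omega>, J t \<omega>) \<in> B t}"
    by (rule past_eventsE)
  let ?b = "{\<omega> \<in> space M. (I k \<omega>, J k \<omega>) \<in> B'}"
  let ?B = "B(k := B')"
  have "a \<inter> ?b = X0 -` A \<inter> {\<omega> \<in> space M. \<forall>t<Suc k. (I t \<omega>, J t \<omega>) \<in> ?B t}"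
    unfolding a by (auto simp: less_Suc_eq)
  hence "prob (a \<inter> ?b) = prob (X0 -` A \<inter> space M) *
      (\<Prod>t<Suc k. prob {\<omega> \<in> space M. (I t \<omega>, J t \<omega>) \<in> ?B t})"
    by (simp only: indep_init_pairs(2)[OF A] prob_pairs)
  also have "(\<Prod>t<Suc k. prob {\<omega> \<in> space M. (I t \<omega>, J t \<omega>) \<in> ?B t}) =
      (\<Prod>t<k. prob {\<omega> \<in> space M. (I t \<omega>, J t \<omega>) \<in> B t}) * prob ?b"
    unfolding prod.lessThan_Suc by (intro arg_cong2[where f = "(*)"] prod.cong) auto
  finally show ?thesis
    by (simp only: a indep_init_pairs(2)[OF A] prob_pairs mult.assoc)
qed

text \<open>Both families of events are closed under intersections, so independence passes to the
  generated sigma-algebras.\<close>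

lemma indep_past_pair:
  "indep_set (sets (past k)) (sigma_sets (space M) (pair_events k))"
  unfolding sets_past
proof (rule indep_set_sigma_sets)
  show "indep_set (past_events k) (pair_events k)"
    unfolding indep_sets2_eq using past_events_events pair_events_subset prob_past_pair
    by (auto simp: pair_events_def)
qed (rule Int_stable_past_events Int_stable_pair_events)+

text \<open>Takes the place of conditioning on the past: a function of the past and an indicator of
  the current pair are independent, so the mean of their product factorizes.\<close>

lemma expectation_past_pair:
  fixes g :: "'w \<Rightarrow> real"
  assumes g: "g \<in> borel_measurable (past k)" and int: "integrable M g"
  shows "integrable M (\<lambda>\<omega>. g \<omega> * indicator B (I k \<omega>, J k \<omega>))"
    and "expectation (\<lambda>\<omega>. g \<omega> * indicator B (I k \<omega>, J k \<omega>)) =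
         expectation g * prob {\<omega> \<in> space M. (I k \<omega>, J k \<omega>) \<in> B}"
proof -
  let ?b = "\<lambda>\<omega>. indicator B (I k \<omega>, J k \<omega>) :: real"
  have indep: "indep_var borel g borel ?b"
  proof (subst indep_var_eq, intro conjI)
    show "random_variable borel g" using measurable_past[OF g] .
    show b: "random_variable borel ?b"
      by (rule measurable_compose[OF measurable_pair]) simp
    have "sigma_sets (space M) {g -` A \<inter> space M |A. A \<in> sets borel} \<subseteq> sets (past k)"
    proof -
      have "{g -` A \<inter> space M |A. A \<in> sets borel} \<subseteq> sets (past k)"
        using measurable_sets[OF g] by auto
      from sets.sigma_sets_subset[OF this] show ?thesis by simp
    qed
    moreover have "sigma_sets (space M) {?b -` A \<inter> space M |A. A \<in> sets borel}
        \<subseteq> sigma_sets (space M) (pair_events k)"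
    proof (rule sigma_sets_mono')
      have "?b -` A \<inter> space M = {\<omega> \<in> space M. (I k \<omega>, J k \<omega>) \<in> indicator B -` A}"
        for A :: "real set" by auto
      thus "{?b -` A \<inter> space M |A. A \<in> sets borel}
        \<subseteq> pair_events k" by (auto simp: pair_events_def)
    qed
    ultimately show "indep_set (sigma_sets (space M) {g -` A \<inter> space M |A. A \<in> sets borel})
        (sigma_sets (space M) {?b -` A \<inter> space M |A. A \<in> sets borel})"
      by (rule indep_set_mono[OF indep_past_pair[of k]])
  qed
  have b: "integrable M ?b"
    by (rule integrable_const_bound[of _ 1])
       (auto simp: indicator_def intro: measurable_compose[OF measurable_pair])
  have eb: "expectation ?b = prob {\<omega> \<in> space M. (I k \<omega>, J k \<omega>) \<in> B}"
  proof -
    have "expectation ?b = expectation (indicator {\<omega> \<in> space M. (I k \<omega>, J k \<omega>) \<in> B})"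
      by (intro Bochner_Integration.integral_cong) (auto simp: indicator_def)
    thus ?thesis by simp
  qed
  show "integrable M (\<lambda>\<omega>. g \<omega> * ?b \<omega>)"
    by (rule indep_var_integrable[OF indep int b])
  show "expectation (\<lambda>\<omega>. g \<omega> * ?b \<omega>) =
         expectation g * prob {\<omega> \<in> space M. (I k \<omega>, J k \<omega>) \<in> B}"
    using indep_var_lebesgue_integral[OF indep int b] unfolding eb .
qed

text \<open>The sum over a random index set becomes a sum over all players with activation
  indicators, and each indicator contributes its probability \<open>P i\<close>.\<close>

lemma expectation_active:
  fixes g :: "'i \<Rightarrow> 'w \<Rightarrow> real"
  assumes g: "\<And>i. g i \<in> borel_measurable (past k)" and int: "\<And>i. integrable M (g i)"
  shows "integrable M (\<lambda>\<omega>. \<Sum>i\<in>{I k \<omega>, J k \<omega>}. g i \<omega>)"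
    and "expectation (\<lambda>\<omega>. \<Sum>i\<in>{I k \<omega>, J k \<omega>}. g i \<omega>) =
         (\<Sum>i\<in>UNIV. update_prob E p i * expectation (g i))"
proof -
  let ?A = "\<lambda>i. {(a, b). i = a \<or> i = b}"
  have eq: "(\<Sum>i\<in>{I k \<omega>, J k \<omega>}. g i \<omega>) =
      (\<Sum>i\<in>UNIV. g i \<omega> * indicator (?A i) (I k \<omega>, J k \<omega>))" for \<omega>
    by (rule sum.mono_neutral_cong_left) (auto simp: indicator_def)
  note * = expectation_past_pair[OF g int]
  show "integrable M (\<lambda>\<omega>. \<Sum>i\<in>{I k \<omega>, J k \<omega>}. g i \<omega>)"
    unfolding eq by (intro Bochner_Integration.integrable_sum *(1))
  have "prob {\<omega> \<in> space M. (I k \<omega>, J k \<omega>) \<in> ?A i} = update_prob E p i" for i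
    using prob_active[of i k] by simp
  thus "expectation (\<lambda>\<omega>. \<Sum>i\<in>{I k \<omega>, J k \<omega>}. g i \<omega>) =
      (\<Sum>i\<in>UNIV. update_prob E p i * expectation (g i))"
    unfolding eq by (subst Bochner_Integration.integral_sum) (simp_all add: * mult.commute)
qed

text \<open>Averages over the finitely many values of the current pair while the past stays fixed.
  The weighted sum remains inside the expectation so that a bound holding pointwise in the past can
  be inserted there.\<close>

lemma expectation_pair:
  fixes g :: "'i \<Rightarrow> 'i \<Rightarrow> 'w \<Rightarrow> real"
  assumes g: "\<And>a b. g a b \<in> borel_measurable (past k)" and int: "\<And>a b. integrable M (g a b)"
  shows "integrable M (\<lambda>\<omega>. g (I k \<omega>) (J k \<omega>) \<omega>)"
    and "expectation (\<lambda>\<omega>. g (I k \<omega>) (J k \<omega>) \<omega>) =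
         expectation (\<lambda>\<omega>. \<Sum>q\<in>UNIV. prob {\<omega> \<in> space M. (I k \<omega>, J k \<omega>) \<in> {q}} * g (fst q) (snd q) \<omega>)"
proof -
  have eq: "g (I k \<omega>) (J k \<omega>) \<omega> =
      (\<Sum>q\<in>UNIV. g (fst q) (snd q) \<omega> * indicator {q} (I k \<omega>, J k \<omega>))" for \<omega>
  proof -
    have "(\<Sum>q\<in>UNIV. g (fst q) (snd q) \<omega> * indicator {q} (I k \<omega>, J k \<omega>)) =
        (\<Sum>q\<in>{(I k \<omega>, J k \<omega>)}. g (fst q) (snd q) \<omega>)"
      by (rule sum.mono_neutral_cong_right) (auto simp: indicator_def)
    thus ?thesis by simp
  qed
  note * = expectation_past_pair[OF g int]
  show "integrable M (\<lambda>\<omega>. g (I k \<omega>) (J k \<omega>) \<omega>)"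
    unfolding eq by (intro Bochner_Integration.integrable_sum *(1))
  show "expectation (\<lambda>\<omega>. g (I k \<omega>) (J k \<omega>) \<omega>) =
      expectation (\<lambda>\<omega>. \<Sum>q\<in>UNIV. prob {\<omega> \<in> space M. (I k \<omega>, J k \<omega>) \<in> {q}} * g (fst q) (snd q) \<omega>)"
  proof -
    have "expectation (\<lambda>\<omega>. \<Sum>q\<in>UNIV. g (fst q) (snd q) \<omega> * indicator {q} (I k \<omega>, J k \<omega>)) =
        (\<Sum>q\<in>UNIV. expectation (g (fst q) (snd q)) * prob {\<omega> \<in> space M. (I k \<omega>, J k \<omega>) \<in> {q}})"
      by (subst Bochner_Integration.integral_sum) (simp_all only: *)
    also have "\<dots> = (\<Sum>q\<in>UNIV. expectation (\<lambda>\<omega>.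
        prob {\<omega> \<in> space M. (I k \<omega>, J k \<omega>) \<in> {q}} * g (fst q) (snd q) \<omega>))"
      by (intro sum.cong refl) (simp add: mult.commute)
    also have "\<dots> = expectation (\<lambda>\<omega>. \<Sum>q\<in>UNIV.
        prob {\<omega> \<in> space M. (I k \<omega>, J k \<omega>) \<in> {q}} * g (fst q) (snd q) \<omega>)"
      by (rule Bochner_Integration.integral_sum[symmetric]) (intro integrable_mult_right int)
    finally show ?thesis unfolding eq .
  qed
qed

end

section \<open>The gossip iteration\<close>

lemma borel_measurable_vec_lambda:
  fixes h :: "'i::finite \<Rightarrow> 'a \<Rightarrow> 'b::euclidean_space"
  assumes "\<And>i. h i \<in> borel_measurable N"
  shows "(\<lambda>\<omega>. \<chi> i. h i \<omega>) \<in> borel_measurable N"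
  by (subst borel_measurable_euclidean_space)
     (auto simp: Basis_vec_def inner_axis intro!: borel_measurable_inner assms)

lemma borel_measurable_vec_component:
  fixes h :: "'a \<Rightarrow> 'b::euclidean_space ^ 'i::finite"
  assumes "h \<in> borel_measurable N"
  shows "(\<lambda>\<omega>. h \<omega> $ i) \<in> borel_measurable N"
  by (rule measurable_compose[OF assms borel_measurable_continuous_onI])
     (intro continuous_intros)

text \<open>A crude estimate, used only for boundedness and hence integrability at each fixed
  time.\<close>

lemma norm_vhat_step_le:
  fixes v :: "(real^'n)^'i::finite"
  shows "norm (vhat_step a b v) \<le> real CARD('i) * norm v"
proof -
  have "norm (vhat_step a b v $ i) \<le> norm v" for i
  proof -
    have "norm ((1/2) *\<^sub>R (v $ a + v $ b)) \<le> norm v"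
      using norm_triangle_ineq[of "v $ a" "v $ b"] Finite_Cartesian_Product.norm_nth_le[of v a]
        Finite_Cartesian_Product.norm_nth_le[of v b] by simp
    thus ?thesis by (simp add: vhat_step_def Finite_Cartesian_Product.norm_nth_le)
  qed
  hence "(\<Sum>i\<in>UNIV. norm (vhat_step a b v $ i)) \<le> (\<Sum>i\<in>(UNIV :: 'i set). norm v)"
    by (intro sum_mono)
  thus ?thesis
    unfolding norm_vec_def[of "vhat_step a b v"]
    by (intro order_trans[OF L2_set_le_sum]) auto
qed

text \<open>Here \<open>\<Lambda>\<close> is a Lipschitz constant in the aggregate common to all
  players. The set \<open>U\<close> contains the true aggregates as well as the scaled estimates,
  which are not a priori aggregates of feasible profiles.\<close>

locale gossip_game = gossip_process M E p I J X0
  for M :: "'w measure"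
    and E :: "'i::finite set set"
    and p :: "'i \<Rightarrow> 'i \<Rightarrow> real"
    and I J :: "nat \<Rightarrow> 'w \<Rightarrow> 'i"
    and X0 :: "'w \<Rightarrow> (real^'n)^'i" +
  fixes K :: "'i \<Rightarrow> (real^'n) set"
    and f :: "'i \<Rightarrow> real^'n \<Rightarrow> real^'n \<Rightarrow> real"
    and U :: "(real^'n) set"
    and \<alpha> :: "'i \<Rightarrow> real"
    and \<Lambda> C lam \<mu> :: real
  assumes stepsizes: "\<And>i. \<alpha> i > 0"
    and init: "\<And>\<omega>. \<omega> \<in> space M \<Longrightarrow> X0 \<omega> \<in> profiles K"
    and dom: "Kbar K \<subseteq> U"
    and dom_vhat: "\<And>i k \<omega>. \<omega> \<in> space M \<Longrightarrow>
                 real CARD('i) *\<^sub>R vhat_seq K f \<alpha> I J X0 k \<omega> $ i \<in> U"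
    and K_sets: "\<And>i. K i \<noteq> {} \<and> compact (K i) \<and> convex (K i)"
    and F_continuous: "\<And>i. continuous_on (K i \<times> U) (\<lambda>(a, u). F f i a u)"
    and strongly_monotone: "\<And>z w. z \<in> profiles K \<Longrightarrow> w \<in> profiles K \<Longrightarrow>
                 (phi f z - phi f w) \<bullet> (z - w) \<ge> \<mu> * (norm (z - w))\<^sup>2"
    and \<Lambda>_nonneg: "\<Lambda> \<ge> 0"
    and lipschitz_u: "\<And>i a z1 z2. a \<in> K i \<Longrightarrow> z1 \<in> U \<Longrightarrow> z2 \<in> U \<Longrightarrow>
                 norm (F f i a z1 - F f i a z2) \<le> \<Lambda> * norm (z1 - z2)"
    and F_bound: "\<And>i k \<omega>. \<omega> \<in> space M \<Longrightarrow>
                 norm (F f i (x_seq K f \<alpha> I J X0 k \<omega> $ i)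
                   (real CARD('i) *\<^sub>R vhat_seq K f \<alpha> I J X0 k \<omega> $ i)) \<le> C"
    and lam: "0 < lam" "lam < 1"
    and lam_bound: "\<And>k z. integral\<^sup>L M (\<lambda>\<omega>.
                 (norm (disagreement_matrix (I k \<omega>) (J k \<omega>) *v z))\<^sup>2) \<le> lam * (norm z)\<^sup>2"
begin

abbreviation "P \<equiv> update_prob E p"
abbreviation "x \<equiv> x_seq K f \<alpha> I J X0"
abbreviation "v \<equiv> v_seq K f \<alpha> I J X0"
abbreviation "vhat \<equiv> vhat_seq K f \<alpha> I J X0"
abbreviation "e k \<omega> \<equiv> deviation (v k \<omega>)"

lemma closed_K: "closed (K i)" and convex_K: "convex (K i)" and K_nonempty: "K i \<noteq> {}"
  using K_sets[of i] compact_imp_closed by auto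

lemma C_nonneg: "C \<ge> 0"
proof -
  obtain \<omega> where "\<omega> \<in> space M" using not_empty by blast
  from order_trans[OF norm_ge_zero F_bound[OF this]] show ?thesis .
qed

lemma x_0: "x 0 \<omega> = X0 \<omega>" and v_0: "v 0 \<omega> = X0 \<omega>"
  by (simp_all add: x_seq_def v_seq_def)

lemma vhat_eq: "vhat k \<omega> = vhat_step (I k \<omega>) (J k \<omega>) (v k \<omega>)"
  by (simp add: vhat_seq_def)

lemma x_Suc: "x (Suc k) \<omega> = x_step K f \<alpha> (I k \<omega>) (J k \<omega>) (x k \<omega>) (v k \<omega>)"
  by (simp add: x_seq_def v_seq_def Let_def split: prod.split)

lemma x_Suc_component:
  "x (Suc k) \<omega> $ i = (if i \<in> {I k \<omega>, J k \<omega>}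
     then closest_point (K i) (x k \<omega> $ i - \<alpha> i *\<^sub>R F f i (x k \<omega> $ i) (real CARD('i) *\<^sub>R vhat k \<omega> $ i))
     else x k \<omega> $ i)"
  by (simp add: x_Suc x_step_def vhat_eq)

text \<open>One formula for all players: an inactive player has increment zero and an estimate
  untouched by averaging.\<close>

lemma v_Suc: "v (Suc k) \<omega> = vhat k \<omega> + (x (Suc k) \<omega> - x k \<omega>)"
proof -
  have "v (Suc k) \<omega> = (\<chi> i. if i \<in> {I k \<omega>, J k \<omega>}
      then vhat k \<omega> $ i + x (Suc k) \<omega> $ i - x k \<omega> $ i else v k \<omega> $ i)"
    unfolding x_seq_def v_seq_def vhat_seq_def by (simp add: Let_def split: prod.split cong: if_cong)
  thus ?thesis by (auto simp: vec_eq_iff x_Suc_component vhat_eq vhat_step_def)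
qed

lemma x_in_profiles: "\<omega> \<in> space M \<Longrightarrow> x k \<omega> \<in> profiles K"
proof (induction k)
  case 0
  thus ?case by (simp add: x_0 init)
next
  case (Suc k)
  thus ?case
    by (auto simp: profiles_def x_Suc_component intro!: closest_point_in_set closed_K K_nonempty)
qed

lemma x_in_K: "\<omega> \<in> space M \<Longrightarrow> x k \<omega> $ i \<in> K i"
  by (rule profiles_component[OF x_in_profiles])

text \<open>The tracking invariant: averaging keeps the aggregate, and the estimates receive the
  same increments as the decisions. It makes the error in the estimated aggregate a multiple of the
  consensus error, see \<open>vhat_diff\<close>.\<close>

lemma aggregate_v: "aggregate (v k \<omega>) = aggregate (x k \<omega>)"
  by (induction k) (simp_all add: x_0 v_0 v_Suc vhat_eq aggregate_add aggregate_diff aggregate_vhat_step)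

lemma e_Suc:
  "e (Suc k) \<omega> = vhat_step (I k \<omega>) (J k \<omega>) (e k \<omega>) + deviation (x (Suc k) \<omega> - x k \<omega>)"
  by (simp add: v_Suc deviation_add vhat_eq deviation_vhat_step)

lemma vhat_diff:
  "real CARD('i) *\<^sub>R vhat k \<omega> $ i - aggregate (x k \<omega>) = real CARD('i) *\<^sub>R vhat_step (I k \<omega>) (J k \<omega>) (e k \<omega>) $ i"
  by (simp add: vhat_step_deviation vhat_eq aggregate_v scaleR_diff_right)

lemma bounded_profiles: obtains b where "\<And>z. z \<in> profiles K \<Longrightarrow> norm z \<le> b"
  using compact_imp_bounded[OF compact_profiles[of K]] K_sets unfolding bounded_iff by blast

text \<open>The bound may grow with \<open>k\<close>; integrability at each time is its only
  purpose.\<close>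

lemma bounded_v: "\<exists>b. \<forall>\<omega>\<in>space M. norm (v k \<omega>) \<le> b"
proof (induction k)
  case 0
  thus ?case using bounded_profiles init by (metis v_0)
next
  case (Suc k)
  obtain b where b: "\<And>z. z \<in> profiles K \<Longrightarrow> norm z \<le> b" using bounded_profiles by blast
  from Suc obtain c where c: "\<And>\<omega>. \<omega> \<in> space M \<Longrightarrow> norm (v k \<omega>) \<le> c" by blast
  have "norm (v (Suc k) \<omega>) \<le> real CARD('i) * c + (b + b)" if \<omega>: "\<omega> \<in> space M" for \<omega>
    unfolding v_Suc
  proof (intro norm_triangle_mono norm_triangle_le_diff add_mono)
    show "norm (vhat k \<omega>) \<le> real CARD('i) * c"
      unfolding vhat_eq by (rule order_trans[OF norm_vhat_step_le]) (simp add: c \<omega>)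
  qed (intro b x_in_profiles \<omega>)+
  thus ?case by blast
qed

lemma bounded_e: "\<exists>b. \<forall>\<omega>\<in>space M. norm (e k \<omega>) \<le> b"
  using bounded_v norm_deviation_le by (meson order_trans)

section \<open>Adaptedness and integrability of the iterates\<close>

lemma measurable_pair_past: "(\<lambda>\<omega>. (I k \<omega>, J k \<omega>)) \<in> measurable (past (Suc k)) (count_space UNIV)"
proof (subst measurable_count_space_eq2)
  show "finite (UNIV :: ('i \<times> 'i) set)" by simp
  have "(\<lambda>\<omega>. (I k \<omega>, J k \<omega>)) -` {q} \<inter> space M \<in> past_events (Suc k)" for q
  proof -
    have "(\<lambda>\<omega>. (I k \<omega>, J k \<omega>)) -` {q} \<inter> space M = X0 -` UNIV \<inter>
        {\<omega> \<in> space M. \<forall>t<Suc k. (I t \<omega>, J t \<omega>) \<in> ((\<lambda>_. UNIV)(k := {q})) t}"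
      by (auto simp: less_Suc_eq)
    also have "\<dots> \<in> past_events (Suc k)" by (rule past_eventsI) simp
    finally show ?thesis .
  qed
  thus "(\<lambda>\<omega>. (I k \<omega>, J k \<omega>)) \<in> space (past (Suc k)) \<rightarrow> UNIV \<and>
    (\<forall>q\<in>UNIV. (\<lambda>\<omega>. (I k \<omega>, J k \<omega>)) -` {q} \<inter> space (past (Suc k)) \<in> sets (past (Suc k)))"
    by (simp add: sets_past)
qed

lemma measurable_past_Suc: "g \<in> measurable (past k) R \<Longrightarrow> g \<in> measurable (past (Suc k)) R"
proof -
  have "past_events k \<subseteq> past_events (Suc k)"
  proof
    fix a assume "a \<in> past_events k"
    then obtain A B where A: "A \<in> sets borel"
      and a: "a = X0 -` A \<inter> {\<omega> \<in> space M. \<forall>t<k. (I t \<omega>, J t \<omega>) \<in> B t}" by (rule past_eventsE)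
    have "a = X0 -` A \<inter> {\<omega> \<in> space M. \<forall>t<Suc k. (I t \<omega>, J t \<omega>) \<in> (B(k := UNIV)) t}"
      unfolding a by (auto simp: less_Suc_eq)
    also have "\<dots> \<in> past_events (Suc k)" using A by (rule past_eventsI)
    finally show "a \<in> past_events (Suc k)" .
  qed
  hence "sets (past k) \<subseteq> sets (past (Suc k))"
    unfolding sets_past by (rule sigma_sets_mono')
  thus "g \<in> measurable (past k) R \<Longrightarrow> g \<in> measurable (past (Suc k)) R"
    by (auto simp: measurable_def)
qed

lemma measurable_pair_dependent:
  assumes "\<And>a b. g a b \<in> measurable (past (Suc k)) R"
  shows "(\<lambda>\<omega>. g (I k \<omega>) (J k \<omega>) \<omega>) \<in> measurable (past (Suc k)) R"
  using measurable_compose_countable[OF _ measurable_pair_past, of "\<lambda>q. g (fst q) (snd q)" k R] assms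
  by simp

lemma measurable_vhat_step:
  fixes h :: "'w \<Rightarrow> (real^'n)^'i"
  assumes "h \<in> borel_measurable R"
  shows "(\<lambda>\<omega>. vhat_step a b (h \<omega>)) \<in> borel_measurable R"
  unfolding vhat_step_def
proof (rule borel_measurable_vec_lambda)
  fix i
  have h: "(\<lambda>\<omega>. h \<omega> $ j) \<in> borel_measurable R" for j
    by (rule borel_measurable_vec_component[OF assms])
  show "(\<lambda>\<omega>. if i \<in> {a, b} then (1/2) *\<^sub>R (h \<omega> $ a + h \<omega> $ b) else h \<omega> $ i) \<in> borel_measurable R"
  proof (cases "i \<in> {a, b}")
    case True
    show ?thesis unfolding if_P[OF True]
      by (intro borel_measurable_scaleR borel_measurable_add borel_measurable_const h)
  next
    case False
    show ?thesis unfolding if_not_P[OF False] by (rule h)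
  qed
qed

text \<open>The state at time \<open>k\<close> is determined by the initial decisions and the pairs
  before \<open>k\<close>. For each value of the current pair the next state is a measurable
  function of the present one, and only finitely many values occur.\<close>

lemma measurable_state: "x k \<in> borel_measurable (past k) \<and> v k \<in> borel_measurable (past k)"
proof (induction k)
  case 0
  have "X0 \<in> borel_measurable (past 0)"
  proof (rule measurableI)
    fix A :: "((real^'n)^'i) set" assume "A \<in> sets borel"
    from past_eventsI[OF this, of 0 "\<lambda>_. UNIV"]
    show "X0 -` A \<inter> space (past 0) \<in> sets (past 0)" by (simp add: sets_past)
  qed simp
  thus ?case by (simp add: x_0[abs_def] v_0[abs_def])
next
  case (Suc k)
  have x: "x k \<in> borel_measurable (past (Suc k))" and v: "v k \<in> borel_measurable (past (Suc k))"
    using Suc measurable_past_Suc by blast+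
  have vhat: "vhat k \<in> borel_measurable (past (Suc k))"
    unfolding vhat_eq[abs_def]
    by (rule measurable_pair_dependent[of "\<lambda>a b \<omega>. vhat_step a b (v k \<omega>)"])
       (rule measurable_vhat_step[OF v])
  have xi: "(\<lambda>\<omega>. x k \<omega> $ i) \<in> borel_measurable (past (Suc k))" for i
    by (rule borel_measurable_vec_component[OF x])
  \<comment> \<open>Continuity of \<open>F\<close> is available only on
    \<open>K i \<times> U\<close>, so the argument is regarded as a map into that restricted
    space.\<close>
  have F: "(\<lambda>\<omega>. F f i (x k \<omega> $ i) (real CARD('i) *\<^sub>R vhat k \<omega> $ i)) \<in> borel_measurable (past (Suc k))" for i
  proof -
    have "(\<lambda>\<omega>. (x k \<omega> $ i, real CARD('i) *\<^sub>R vhat k \<omega> $ i)) \<in>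
        measurable (past (Suc k)) (restrict_space borel (K i \<times> U))"
    proof (rule measurable_restrict_space2)
      show "(\<lambda>\<omega>. (x k \<omega> $ i, real CARD('i) *\<^sub>R vhat k \<omega> $ i)) \<in>
          space (past (Suc k)) \<rightarrow> K i \<times> U"
        by (simp add: x_in_K dom_vhat)
    qed (intro borel_measurable_Pair borel_measurable_scaleR
          borel_measurable_const borel_measurable_vec_component x vhat)
    from measurable_compose[OF this borel_measurable_continuous_on_restrict[OF F_continuous]]
    show ?thesis by simp
  qed
  have cp: "closest_point (K i) \<in> borel_measurable borel" for i
    by (intro borel_measurable_continuous_onI continuous_on_closest_point convex_K closed_K K_nonempty)
  let ?x = "\<lambda>i a b \<omega>. if i \<in> {a, b}
      then closest_point (K i) (x k \<omega> $ i - \<alpha> i *\<^sub>R F f i (x k \<omega> $ i) (real CARD('i) *\<^sub>R vhat k \<omega> $ i))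
      else x k \<omega> $ i"
  have step: "?x i a b \<in> borel_measurable (past (Suc k))" for i a b
  proof (cases "i \<in> {a, b}")
    case True
    show ?thesis unfolding if_P[OF True]
      by (rule measurable_compose[OF _ cp])
         (intro borel_measurable_diff xi borel_measurable_scaleR borel_measurable_const F)
  next
    case False
    show ?thesis unfolding if_not_P[OF False] by (rule xi)
  qed
  have "(\<lambda>\<omega>. x (Suc k) \<omega> $ i) \<in> borel_measurable (past (Suc k))" for i
    unfolding x_Suc_component by (rule measurable_pair_dependent[of "?x i", OF step])
  hence "(\<lambda>\<omega>. \<chi> i. x (Suc k) \<omega> $ i) \<in> borel_measurable (past (Suc k))"
    by (rule borel_measurable_vec_lambda)
  hence x': "x (Suc k) \<in> borel_measurable (past (Suc k))" by simp
  have "v (Suc k) \<in> borel_measurable (past (Suc k))"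
    unfolding v_Suc[abs_def] by (intro borel_measurable_add borel_measurable_diff vhat x x')
  with x' show ?case ..
qed

lemma measurable_x: "x k \<in> borel_measurable (past k)"
  and measurable_v: "v k \<in> borel_measurable (past k)"
  using measurable_state by blast+

lemma measurable_e: "(\<lambda>\<omega>. e k \<omega>) \<in> borel_measurable (past k)"
  unfolding deviation_def aggregate_def
  by (intro borel_measurable_vec_lambda borel_measurable_diff borel_measurable_scaleR
      borel_measurable_const borel_measurable_sum borel_measurable_vec_component measurable_v)

lemma integrable_past:
  fixes g :: "'w \<Rightarrow> real"
  assumes "g \<in> borel_measurable (past k)" and "\<And>\<omega>. \<omega> \<in> space M \<Longrightarrow> \<bar>g \<omega>\<bar> \<le> b"
  shows "integrable M g"
  by (rule integrable_const_bound[of _ b]) (use assms measurable_past in auto)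

lemma integrable_norm_sq:
  fixes h :: "'w \<Rightarrow> 'b::euclidean_space"
  assumes "h \<in> borel_measurable (past k)" and "\<And>\<omega>. \<omega> \<in> space M \<Longrightarrow> norm (h \<omega>) \<le> b"
  shows "integrable M (\<lambda>\<omega>. (norm (h \<omega>))\<^sup>2)"
  by (rule integrable_past[of _ k "b\<^sup>2"])
     (use assms in \<open>auto intro!: borel_measurable_power borel_measurable_norm power_mono\<close>)

lemma sum_prob_vhat_step_le:
  assumes "aggregate d = 0"
  shows "(\<Sum>q\<in>UNIV. prob {\<omega> \<in> space M. (I k \<omega>, J k \<omega>) \<in> {q}} *
           (norm (vhat_step (fst q) (snd q) d))\<^sup>2) \<le> lam * (norm (d :: (real^'n)^'i))\<^sup>2"
proof -
  let ?p = "\<lambda>q. prob {\<omega> \<in> space M. (I k \<omega>, J k \<omega>) \<in> {q}}"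
  let ?D = "\<lambda>a b c. (norm (disagreement_matrix a b *v (\<chi> i. d $ i $ c)))\<^sup>2"
  have "(\<Sum>q\<in>UNIV. ?p q * (norm (vhat_step (fst q) (snd q) d))\<^sup>2) =
      (\<Sum>q\<in>UNIV. \<Sum>c\<in>UNIV. ?p q * ?D (fst q) (snd q) c)"
    by (simp add: norm_sq_vhat_step[OF assms] sum_distrib_left)
  also have "\<dots> = (\<Sum>c\<in>UNIV. \<Sum>q\<in>UNIV. ?p q * ?D (fst q) (snd q) c)"
    by (rule sum.swap)
  \<comment> \<open>With \<open>d\<close> fixed the summands do not depend on the past, so
    \<open>expectation_pair\<close> reads the weighted sum as an expectation over the pair.\<close>
  also have "\<dots> = (\<Sum>c\<in>UNIV. expectation (\<lambda>\<omega>. ?D (I k \<omega>) (J k \<omega>) c))"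
    by (intro sum.cong refl, subst expectation_pair(2)) (simp_all add: prob_space)
  also have "\<dots> \<le> (\<Sum>c\<in>UNIV. lam * (norm (\<chi> i. d $ i $ c))\<^sup>2)"
    by (intro sum_mono lam_bound)
  also have "\<dots> = lam * (norm d)\<^sup>2"
    by (simp add: norm_sq_eq_sum_columns[of d] sum_distrib_left)
  finally show ?thesis .
qed

text \<open>Only the two active players move. A feasible decision is its own projection and
  projections are nonexpansive, so each of them moves by at most
  \<open>\<alpha> i * C\<close>.\<close>

lemma norm_step_le:
  assumes \<omega>: "\<omega> \<in> space M" and a: "\<And>i. \<alpha> i * C \<le> a"
  shows "(norm (x (Suc k) \<omega> - x k \<omega>))\<^sup>2 \<le> 2 * a\<^sup>2"
proof -
  have "norm (x (Suc k) \<omega> $ i - x k \<omega> $ i) \<le> a" if "i \<in> {I k \<omega>, J k \<omega>}" for i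
  proof -
    let ?F = "F f i (x k \<omega> $ i) (real CARD('i) *\<^sub>R vhat k \<omega> $ i)"
    have "norm (x (Suc k) \<omega> $ i - x k \<omega> $ i) =
        dist (closest_point (K i) (x k \<omega> $ i - \<alpha> i *\<^sub>R ?F)) (closest_point (K i) (x k \<omega> $ i))"
      using that by (simp add: x_Suc_component closest_point_self x_in_K \<omega> dist_norm)
    also have "\<dots> \<le> dist (x k \<omega> $ i - \<alpha> i *\<^sub>R ?F) (x k \<omega> $ i)"
      by (intro closest_point_lipschitz convex_K closed_K K_nonempty)
    also have "\<dots> = \<alpha> i * norm ?F" using stepsizes[of i] by (simp add: dist_norm)
    also have "\<dots> \<le> \<alpha> i * C" using stepsizes[of i] F_bound[OF \<omega>] by (intro mult_left_mono) auto
    finally show ?thesis using a[of i] by simp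
  qed
  hence *: "(norm (x (Suc k) \<omega> $ i - x k \<omega> $ i))\<^sup>2 \<le> a\<^sup>2" if "i \<in> {I k \<omega>, J k \<omega>}" for i
    using that by (intro power_mono) auto
  have "(norm (x (Suc k) \<omega> - x k \<omega>))\<^sup>2 =
      (\<Sum>i\<in>{I k \<omega>, J k \<omega>}. (norm (x (Suc k) \<omega> $ i - x k \<omega> $ i))\<^sup>2)"
    unfolding norm_sq_vec[of "x (Suc k) \<omega> - x k \<omega>"]
    by (rule sum.mono_neutral_cong_right) (auto simp: x_Suc_component)
  also have "\<dots> \<le> (\<Sum>i\<in>{I k \<omega>, J k \<omega>}. a\<^sup>2)" by (intro sum_mono *)
  also have "\<dots> = 2 * a\<^sup>2" using I_neq_J[OF \<omega>] by simp
  finally show ?thesis .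
qed

text \<open>Young's inequality with \<open>r = sqrt lam\<close> divides the averaged part by
  \<open>sqrt lam\<close>, turning the mean factor \<open>lam\<close> into \<open>sqrt lam\<close>;
  the increment of the decisions is divided by \<open>1 - sqrt lam\<close>.\<close>

lemma deviation_recursion:
  assumes a: "\<And>i. \<alpha> i * C \<le> a"
  shows "expectation (\<lambda>\<omega>. (norm (e (Suc k) \<omega>))\<^sup>2)
    \<le> sqrt lam * expectation (\<lambda>\<omega>. (norm (e k \<omega>))\<^sup>2) + 2 * a\<^sup>2 / (1 - sqrt lam)"
proof -
  have r: "0 < sqrt lam" "sqrt lam < 1" using lam by (auto simp: real_sqrt_lt_1_iff)
  obtain b where b: "\<And>\<omega>. \<omega> \<in> space M \<Longrightarrow> norm (e k \<omega>) \<le> b" using bounded_e by blast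
  obtain b' where b': "\<And>\<omega>. \<omega> \<in> space M \<Longrightarrow> norm (e (Suc k) \<omega>) \<le> b'" using bounded_e by blast
  let ?g = "\<lambda>a b \<omega>. (norm (vhat_step a b (e k \<omega>)))\<^sup>2"
  have ms: "(\<lambda>\<omega>. vhat_step a b (e k \<omega>)) \<in> borel_measurable (past k)" for a b
    by (intro measurable_vhat_step measurable_e)
  have g: "?g a b \<in> borel_measurable (past k)" for a b
    by (intro borel_measurable_power measurable_compose[OF ms]) simp
  have gi: "integrable M (?g c d)" for c d
    by (rule integrable_norm_sq[OF ms, of _ _ "real CARD('i) * b"])
       (auto intro!: order_trans[OF norm_vhat_step_le] mult_left_mono b)
  note pair = expectation_pair[of ?g k, OF g gi]
  have le: "(norm (e (Suc k) \<omega>))\<^sup>2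
      \<le> ?g (I k \<omega>) (J k \<omega>) \<omega> / sqrt lam + 2 * a\<^sup>2 / (1 - sqrt lam)"
    if \<omega>: "\<omega> \<in> space M" for \<omega>
  proof -
    have "(norm (e (Suc k) \<omega>))\<^sup>2 \<le> ?g (I k \<omega>) (J k \<omega>) \<omega> / sqrt lam
        + (norm (deviation (x (Suc k) \<omega> - x k \<omega>)))\<^sup>2 / (1 - sqrt lam)"
      unfolding e_Suc by (rule norm_add_square_le[OF r])
    moreover have "(norm (deviation (x (Suc k) \<omega> - x k \<omega>)))\<^sup>2 \<le> 2 * a\<^sup>2"
      by (rule order_trans[OF power_mono[OF norm_deviation_le] norm_step_le[OF \<omega> a]]) simp
    ultimately show ?thesis
      using r by (smt (verit) divide_right_mono)
  qed
  have "expectation (\<lambda>\<omega>. (norm (e (Suc k) \<omega>))\<^sup>2)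
      \<le> expectation (\<lambda>\<omega>. ?g (I k \<omega>) (J k \<omega>) \<omega> / sqrt lam + 2 * a\<^sup>2 / (1 - sqrt lam))"
    by (intro integral_mono le integrable_norm_sq[OF measurable_e b'] Bochner_Integration.integrable_add
        integrable_divide_zero pair(1) integrable_const) auto
  also have "\<dots> = expectation (\<lambda>\<omega>. ?g (I k \<omega>) (J k \<omega>) \<omega>) / sqrt lam + 2 * a\<^sup>2 / (1 - sqrt lam)"
    using pair(1) by (simp add: prob_space)
  \<comment> \<open>The contraction for a frozen error is inserted at the past value
    \<open>e k \<omega>\<close>, whose aggregate is zero.\<close>
  also have "expectation (\<lambda>\<omega>. ?g (I k \<omega>) (J k \<omega>) \<omega>) \<le> expectation (\<lambda>\<omega>. lam * (norm (e k \<omega>))\<^sup>2)"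
    unfolding pair(2)
    by (intro integral_mono Bochner_Integration.integrable_sum integrable_mult_right gi
        integrable_norm_sq[OF measurable_e b] sum_prob_vhat_step_le aggregate_deviation) auto
  also have "expectation (\<lambda>\<omega>. lam * (norm (e k \<omega>))\<^sup>2) / sqrt lam =
      sqrt lam * expectation (\<lambda>\<omega>. (norm (e k \<omega>))\<^sup>2)"
    using lam real_sqrt_pow2[of lam] by (simp add: field_simps power2_eq_square)
  finally show ?thesis using r by (simp add: divide_right_mono)
qed

lemma phi_continuous: "continuous_on (profiles K) (phi f)"
  by (rule continuous_on_phi[OF F_continuous dom])

text \<open>The iterates stay in the compact set of profiles, where a continuous function is
  bounded.\<close>

lemma continuous_on_x:
  fixes g :: "(real^'n)^'i \<Rightarrow> real"
  assumes "continuous_on (profiles K) g"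
  shows measurable_continuous_x: "(\<lambda>\<omega>. g (x k \<omega>)) \<in> borel_measurable (past k)"
    and integrable_continuous_x: "integrable M (\<lambda>\<omega>. g (x k \<omega>))"
proof -
  have "x k \<in> measurable (past k) (restrict_space borel (profiles K))"
    by (intro measurable_restrict_space2 measurable_x) (simp add: x_in_profiles)
  from measurable_compose[OF this borel_measurable_continuous_on_restrict[OF assms]]
  show m: "(\<lambda>\<omega>. g (x k \<omega>)) \<in> borel_measurable (past k)" .
  have "compact (g ` profiles K)"
    using K_sets by (intro compact_continuous_image assms compact_profiles) auto
  hence "bounded (g ` profiles K)" by (rule compact_imp_bounded)
  then obtain b where "\<And>z. z \<in> profiles K \<Longrightarrow> \<bar>g z\<bar> \<le> b"
    unfolding bounded_iff by force
  thus "integrable M (\<lambda>\<omega>. g (x k \<omega>))"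
    by (intro integrable_past[OF m, of b]) (simp add: x_in_profiles)
qed

section \<open>The weighted Lyapunov function\<close>

definition lyapunov :: "(real^'n)^'i \<Rightarrow> (real^'n)^'i \<Rightarrow> real" where
  "lyapunov z y = (\<Sum>i\<in>UNIV. (norm (y $ i - z $ i))\<^sup>2 / (P i * \<alpha> i))"

lemma P_pos: "P i > 0"
  by (rule update_prob_pos)

lemma lyapunov_nonneg: "lyapunov z y \<ge> 0"
  unfolding lyapunov_def
  by (intro sum_nonneg divide_nonneg_pos mult_pos_pos P_pos stepsizes) simp

lemma continuous_on_lyapunov: "continuous_on S (lyapunov z)"
  unfolding lyapunov_def[abs_def] using P_pos stepsizes
  by (intro continuous_intros) (auto simp: less_imp_neq[symmetric])

lemma norm_sq_le_lyapunov:
  assumes "\<And>i. P i \<le> Pm" and "\<And>i. \<alpha> i \<le> am"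
  shows "(norm (y - z))\<^sup>2 \<le> Pm * am * lyapunov z y"
  unfolding norm_sq_vec[of "y - z"] lyapunov_def sum_distrib_left
proof (rule sum_mono)
  fix i
  have "P i * \<alpha> i \<le> Pm * am"
    using assms[of i] P_pos[of i] stepsizes[of i] by (intro mult_mono) auto
  thus "(norm ((y - z) $ i))\<^sup>2 \<le> Pm * am * ((norm (y $ i - z $ i))\<^sup>2 / (P i * \<alpha> i))"
    using P_pos[of i] stepsizes[of i]
    by (simp add: pos_le_divide_eq mult_right_mono mult.commute[of "(norm _)\<^sup>2"])
qed

lemma lyapunov_le_norm_sq:
  assumes "\<And>i. m \<le> P i * \<alpha> i" and "m \<ge> 0"
  shows "m * lyapunov z y \<le> (norm (y - z))\<^sup>2"
  unfolding norm_sq_vec[of "y - z"] lyapunov_def sum_distrib_left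
proof (rule sum_mono)
  fix i
  show "m * ((norm (y $ i - z $ i))\<^sup>2 / (P i * \<alpha> i)) \<le> (norm ((y - z) $ i))\<^sup>2"
    using P_pos[of i] stepsizes[of i] assms(1)[of i]
    by (simp add: pos_divide_le_eq mult_right_mono mult.commute[of "(norm _)\<^sup>2"])
qed

text \<open>The projection leaves \<open>z $ i\<close> fixed and is nonexpansive, so the squared
  error can be expanded as for an unprojected gradient step; the factor
  \<open>1 / (P i * \<alpha> i)\<close> then removes the stepsize from the gradient term.\<close>

lemma component_step:
  assumes z: "VI_solution (profiles K) (phi f) z" and \<omega>: "\<omega> \<in> space M"
    and i: "i \<in> {I k \<omega>, J k \<omega>}" and \<theta>: "\<theta> > 0"
  shows "(norm (x (Suc k) \<omega> $ i - z $ i))\<^sup>2 / (P i * \<alpha> i)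
    \<le> (norm (x k \<omega> $ i - z $ i))\<^sup>2 / (P i * \<alpha> i)
      + (\<alpha> i * C\<^sup>2 - 2 * (phi f (x k \<omega>) $ i \<bullet> (x k \<omega> $ i - z $ i))) / P i
      + \<Lambda> * real CARD('i) * (\<theta> * (norm (vhat_step (I k \<omega>) (J k \<omega>) (e k \<omega>) $ i))\<^sup>2
          + (norm (x k \<omega> $ i - z $ i))\<^sup>2 / (\<theta> * (P i)\<^sup>2))"
proof -
  define X where "X = x k \<omega> $ i - z $ i"
  define Fh where "Fh = F f i (x k \<omega> $ i) (real CARD('i) *\<^sub>R vhat k \<omega> $ i)"
  define G where "G = phi f (x k \<omega>) $ i"
  define w where "w = norm (vhat_step (I k \<omega>) (J k \<omega>) (e k \<omega>) $ i)"
  have zK: "z $ i \<in> K i" using z by (simp add: VI_solution_def profiles_def)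
  have \<alpha>: "\<alpha> i > 0" and P: "P i > 0" by (rule stepsizes P_pos)+
  have "norm (x (Suc k) \<omega> $ i - z $ i) =
      dist (closest_point (K i) (x k \<omega> $ i - \<alpha> i *\<^sub>R Fh)) (closest_point (K i) (z $ i))"
    using i zK by (simp add: x_Suc_component closest_point_self dist_norm Fh_def)
  also have "\<dots> \<le> dist (x k \<omega> $ i - \<alpha> i *\<^sub>R Fh) (z $ i)"
    by (intro closest_point_lipschitz convex_K closed_K K_nonempty)
  also have "\<dots> = norm (X - \<alpha> i *\<^sub>R Fh)" by (simp add: dist_norm X_def algebra_simps)
  finally have "(norm (x (Suc k) \<omega> $ i - z $ i))\<^sup>2 \<le> (norm (X - \<alpha> i *\<^sub>R Fh))\<^sup>2"
    by (rule power_mono) simp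
  \<comment> \<open>The gradient \<open>Fh\<close> at the estimate is split into the true game
    gradient \<open>G\<close>, kept for strong monotonicity, and an error controlled by the
    Lipschitz condition in the aggregate.\<close>
  also have "\<dots> = (norm X)\<^sup>2 - 2 * \<alpha> i * (G \<bullet> X) + 2 * \<alpha> i * ((G - Fh) \<bullet> X) + (\<alpha> i)\<^sup>2 * (norm Fh)\<^sup>2"
    by (simp add: power2_norm_eq_inner inner_diff_left inner_diff_right inner_commute algebra_simps)
       (simp add: power2_eq_square)
  also have "\<dots> \<le> (norm X)\<^sup>2 - 2 * \<alpha> i * (G \<bullet> X)
      + 2 * \<alpha> i * (\<Lambda> * real CARD('i) * w * norm X) + (\<alpha> i)\<^sup>2 * C\<^sup>2"
  proof (intro add_mono mult_left_mono order_refl)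
    have "norm (Fh - G) \<le> \<Lambda> * norm (real CARD('i) *\<^sub>R vhat k \<omega> $ i - aggregate (x k \<omega>))"
      unfolding Fh_def G_def phi_def vec_lambda_beta
      using dom x_in_profiles[OF \<omega>]
      by (intro lipschitz_u x_in_K dom_vhat \<omega>) (auto simp: Kbar_def)
    also have "\<dots> = \<Lambda> * real CARD('i) * w" by (simp add: vhat_diff w_def)
    finally have "norm (G - Fh) \<le> \<Lambda> * real CARD('i) * w" by (simp add: norm_minus_commute)
    from mult_right_mono[OF this norm_ge_zero[of X]] norm_cauchy_schwarz[of "G - Fh" X]
    show "(G - Fh) \<bullet> X \<le> \<Lambda> * real CARD('i) * w * norm X" by linarith
    show "(norm Fh)\<^sup>2 \<le> C\<^sup>2" unfolding Fh_def by (intro power_mono F_bound \<omega>) simp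
  qed (use \<alpha> in auto)
  finally have "(norm (x (Suc k) \<omega> $ i - z $ i))\<^sup>2 / (P i * \<alpha> i)
      \<le> ((norm X)\<^sup>2 - 2 * \<alpha> i * (G \<bullet> X)
      + 2 * \<alpha> i * (\<Lambda> * real CARD('i) * w * norm X) + (\<alpha> i)\<^sup>2 * C\<^sup>2) / (P i * \<alpha> i)"
    using \<alpha> P by (intro divide_right_mono) auto
  also have "\<dots> = (norm X)\<^sup>2 / (P i * \<alpha> i) + (\<alpha> i * C\<^sup>2 - 2 * (G \<bullet> X)) / P i
      + \<Lambda> * real CARD('i) * (2 * w * norm X / P i)"
    using \<alpha> P by (simp add: field_simps power2_eq_square)
  \<comment> \<open>The whole factor \<open>1 / P i\<close> goes to the decision error. This leaves
    \<open>w\<^sup>2\<close> with a weight equal for all players, as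
    \<open>sum_active_vhat_step_le\<close> requires.\<close>
  also have "2 * w * norm X / P i \<le> \<theta> * w\<^sup>2 + (norm X)\<^sup>2 / (\<theta> * (P i)\<^sup>2)"
  proof -
    have "0 \<le> (\<theta> * w - norm X / P i)\<^sup>2 / \<theta>" using \<theta> by simp
    also have "\<dots> = \<theta> * w\<^sup>2 + (norm X)\<^sup>2 / (\<theta> * (P i)\<^sup>2) - 2 * w * norm X / P i"
      using \<theta> P by (simp add: field_simps power2_eq_square)
    finally show ?thesis by simp
  qed
  finally show ?thesis
    using \<Lambda>_nonneg by (simp add: X_def G_def w_def mult_left_mono)
qed

text \<open>Terms of inactive players cancel. Replacing the averaged consensus error by the one
  before averaging lets the right-hand side depend on the current pair only through the index set of
  the sum, which is the form treated by \<open>expectation_active\<close>.\<close>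

lemma lyapunov_step:
  assumes z: "VI_solution (profiles K) (phi f) z" and \<omega>: "\<omega> \<in> space M" and \<theta>: "\<theta> > 0"
  shows "lyapunov z (x (Suc k) \<omega>) \<le> lyapunov z (x k \<omega>) + (\<Sum>i\<in>{I k \<omega>, J k \<omega>}.
      (\<alpha> i * C\<^sup>2 - 2 * (phi f (x k \<omega>) $ i \<bullet> (x k \<omega> $ i - z $ i))) / P i
      + \<Lambda> * real CARD('i) * (\<theta> * (norm (e k \<omega> $ i))\<^sup>2
          + (norm (x k \<omega> $ i - z $ i))\<^sup>2 / (\<theta> * (P i)\<^sup>2)))"
proof -
  let ?A = "{I k \<omega>, J k \<omega>}"
  let ?t = "\<lambda>k i. (norm (x k \<omega> $ i - z $ i))\<^sup>2 / (P i * \<alpha> i)"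
  let ?g = "\<lambda>i. (\<alpha> i * C\<^sup>2 - 2 * (phi f (x k \<omega>) $ i \<bullet> (x k \<omega> $ i - z $ i))) / P i"
  let ?w = "\<lambda>i. (norm (vhat_step (I k \<omega>) (J k \<omega>) (e k \<omega>) $ i))\<^sup>2"
  let ?s = "\<lambda>i. (norm (x k \<omega> $ i - z $ i))\<^sup>2 / (\<theta> * (P i)\<^sup>2)"
  have split: "lyapunov z (x l \<omega>) = sum (?t l) ?A + sum (?t l) (UNIV - ?A)" for l
    unfolding lyapunov_def by (subst sum.subset_diff[of ?A]) (auto simp: add.commute)
  have "sum (?t (Suc k)) (UNIV - ?A) = sum (?t k) (UNIV - ?A)"
    by (intro sum.cong refl) (simp add: x_Suc_component)
  moreover have "sum (?t (Suc k)) ?A \<le>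
      (\<Sum>i\<in>?A. ?t k i + ?g i + \<Lambda> * real CARD('i) * (\<theta> * ?w i + ?s i))"
    by (intro sum_mono component_step[OF z \<omega> _ \<theta>])
  ultimately have "lyapunov z (x (Suc k) \<omega>) \<le> lyapunov z (x k \<omega>)
      + (\<Sum>i\<in>?A. ?g i) + \<Lambda> * real CARD('i) * (\<theta> * (\<Sum>i\<in>?A. ?w i) + (\<Sum>i\<in>?A. ?s i))"
    by (simp only: split sum.distrib sum_distrib_left distrib_left)
  also have "\<dots> \<le> lyapunov z (x k \<omega>) + (\<Sum>i\<in>?A. ?g i)
      + \<Lambda> * real CARD('i) * (\<theta> * (\<Sum>i\<in>?A. (norm (e k \<omega> $ i))\<^sup>2) + (\<Sum>i\<in>?A. ?s i))"
    using \<Lambda>_nonneg \<theta>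
    by (intro add_mono mult_left_mono order_refl sum_active_vhat_step_le) auto
  also have "\<dots> = lyapunov z (x k \<omega>) + (\<Sum>i\<in>?A. ?g i
      + \<Lambda> * real CARD('i) * (\<theta> * (norm (e k \<omega> $ i))\<^sup>2 + ?s i))"
    by (simp only: sum.distrib sum_distrib_left distrib_left)
  finally show ?thesis .
qed

text \<open>In the mean each active term gains the factor \<open>P i\<close>, so the gradient terms
  recombine into \<open>phi f (x k \<omega>) \<bullet> (x k \<omega> - z)\<close>, to which strong
  monotonicity of the whole map applies. The number \<open>c\<close> is the contraction extracted
  from it.\<close>

lemma lyapunov_recursion:
  assumes z: "VI_solution (profiles K) (phi f) z" and \<theta>: "\<theta> > 0"
    and Pm: "\<And>i. P i \<le> Pm" and am: "\<And>i. \<alpha> i \<le> am"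
    and m: "\<And>i. m \<le> P i * \<alpha> i" "m \<ge> 0" and c: "c \<le> 2 * \<mu> * m" and \<mu>: "\<mu> \<ge> 0"
  shows "expectation (\<lambda>\<omega>. lyapunov z (x (Suc k) \<omega>))
    \<le> (1 - c + \<Lambda> * real CARD('i) * (am / \<theta>)) * expectation (\<lambda>\<omega>. lyapunov z (x k \<omega>))
      + (real CARD('i) * am * C\<^sup>2
         + \<Lambda> * real CARD('i) * (\<theta> * Pm * expectation (\<lambda>\<omega>. (norm (e k \<omega>))\<^sup>2)))"
proof -
  let ?V = "\<lambda>k \<omega>. lyapunov z (x k \<omega>)"
  let ?G = "\<lambda>i \<omega>. phi f (x k \<omega>) $ i \<bullet> (x k \<omega> $ i - z $ i)"
  let ?h = "\<lambda>i \<omega>. (\<alpha> i * C\<^sup>2 - 2 * ?G i \<omega>) / P i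
      + \<Lambda> * real CARD('i) * (\<theta> * (norm (e k \<omega> $ i))\<^sup>2
          + (norm (x k \<omega> $ i - z $ i))\<^sup>2 / (\<theta> * (P i)\<^sup>2))"
  let ?H = "\<lambda>\<omega>. real CARD('i) * am * C\<^sup>2 - c * ?V k \<omega>
      + \<Lambda> * real CARD('i) * (\<theta> * Pm * (norm (e k \<omega>))\<^sup>2 + am / \<theta> * ?V k \<omega>)"
  have V: "integrable M (?V l)" for l
    by (rule integrable_continuous_x[OF continuous_on_lyapunov])
  obtain b where b: "\<And>\<omega>. \<omega> \<in> space M \<Longrightarrow> norm (e k \<omega>) \<le> b" using bounded_e by blast
  have E: "integrable M (\<lambda>\<omega>. (norm (e k \<omega>))\<^sup>2)"
    by (rule integrable_norm_sq[OF measurable_e b])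
  have ei: "(\<lambda>\<omega>. e k \<omega> $ i) \<in> borel_measurable (past k)" for i
    by (rule borel_measurable_vec_component[OF measurable_e])
  have Ei: "integrable M (\<lambda>\<omega>. (norm (e k \<omega> $ i))\<^sup>2)" for i
    by (rule integrable_norm_sq[OF ei order_trans[OF Finite_Cartesian_Product.norm_nth_le b]])
  have Eim: "(\<lambda>\<omega>. (norm (e k \<omega> $ i))\<^sup>2) \<in> borel_measurable (past k)" for i
    by (intro borel_measurable_power measurable_compose[OF ei]) simp
  have cG: "continuous_on (profiles K) (\<lambda>y. phi f y $ i \<bullet> (y $ i - z $ i))" for i
    by (intro continuous_intros phi_continuous)
  have cX: "continuous_on (profiles K) (\<lambda>y. (norm (y $ i - z $ i))\<^sup>2)" for i
    by (intro continuous_intros)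
  have hm: "?h i \<in> borel_measurable (past k)" for i
    by (intro borel_measurable_add borel_measurable_divide borel_measurable_diff
        borel_measurable_times borel_measurable_const Eim
        measurable_continuous_x[OF cG] measurable_continuous_x[OF cX])
  have hi: "integrable M (?h i)" for i
    by (intro Bochner_Integration.integrable_add integrable_divide_zero
        Bochner_Integration.integrable_diff integrable_mult_right integrable_const Ei
        integrable_continuous_x[OF cG] integrable_continuous_x[OF cX])
  note active = expectation_active[of ?h k, OF hm hi]
  have le: "(\<Sum>i\<in>UNIV. P i * ?h i \<omega>) \<le> ?H \<omega>" if \<omega>: "\<omega> \<in> space M" for \<omega>
  proof -
    let ?X = "\<lambda>i. (norm (x k \<omega> $ i - z $ i))\<^sup>2"
    \<comment> \<open>One factor \<open>P i\<close> cancels. The decision error keeps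
      \<open>1 / (\<theta> * P i)\<close>, which is \<open>\<alpha> i / \<theta>\<close> times its
      Lyapunov weight.\<close>
    have eq: "(\<Sum>i\<in>UNIV. P i * ?h i \<omega>) = (\<Sum>i\<in>UNIV. \<alpha> i * C\<^sup>2) - 2 * (\<Sum>i\<in>UNIV. ?G i \<omega>)
        + \<Lambda> * real CARD('i) * (\<theta> * (\<Sum>i\<in>UNIV. P i * (norm (e k \<omega> $ i))\<^sup>2)
          + (\<Sum>i\<in>UNIV. ?X i / (\<theta> * P i)))"
    proof -
      have "P i * ?h i \<omega> = \<alpha> i * C\<^sup>2 - 2 * ?G i \<omega> + (\<Lambda> * real CARD('i) *
          (\<theta> * (P i * (norm (e k \<omega> $ i))\<^sup>2)) + \<Lambda> * real CARD('i) * (?X i / (\<theta> * P i)))" for i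
        using P_pos[of i] \<theta> by (simp add: field_simps power2_eq_square)
      thus ?thesis
        by (simp only: sum.distrib sum_subtractf sum_distrib_left distrib_left)
    qed
    have A: "(\<Sum>i\<in>UNIV. \<alpha> i * C\<^sup>2) \<le> real CARD('i) * am * C\<^sup>2"
      using sum_bounded_above[of UNIV "\<lambda>i. \<alpha> i * C\<^sup>2" "am * C\<^sup>2"] am
      by (simp add: mult_right_mono mult.assoc)
    have Es: "(\<Sum>i\<in>UNIV. P i * (norm (e k \<omega> $ i))\<^sup>2) \<le> Pm * (norm (e k \<omega>))\<^sup>2"
      unfolding norm_sq_vec[of "e k \<omega>"] sum_distrib_left
      by (intro sum_mono mult_right_mono Pm) simp
    have Xs: "(\<Sum>i\<in>UNIV. ?X i / (\<theta> * P i)) \<le> am / \<theta> * ?V k \<omega>"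
      unfolding lyapunov_def sum_distrib_left
    proof (rule sum_mono)
      fix i
      have "?X i / (\<theta> * P i) = \<alpha> i / \<theta> * (?X i / (P i * \<alpha> i))"
        using stepsizes[of i] by (simp add: field_simps)
      also have "\<dots> \<le> am / \<theta> * (?X i / (P i * \<alpha> i))"
        using \<theta> P_pos[of i] stepsizes[of i] am[of i]
        by (intro mult_right_mono divide_right_mono) auto
      finally show "?X i / (\<theta> * P i) \<le> am / \<theta> * (?X i / (P i * \<alpha> i))" .
    qed
    \<comment> \<open>Strong monotonicity between the iterate and \<open>z\<close>, followed by the
      variational inequality at \<open>z\<close> to drop \<open>phi f z\<close>; \<open>m\<close>
      bounds the Lyapunov weights from above by \<open>1 / m\<close>.\<close>
    have Gs: "c * ?V k \<omega> \<le> 2 * (\<Sum>i\<in>UNIV. ?G i \<omega>)"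
    proof -
      have zK: "z \<in> profiles K" using z by (simp add: VI_solution_def)
      have "c * ?V k \<omega> \<le> 2 * \<mu> * m * ?V k \<omega>" by (intro mult_right_mono c lyapunov_nonneg)
      also have "\<dots> \<le> 2 * (\<mu> * (norm (x k \<omega> - z))\<^sup>2)"
        using mult_left_mono[OF lyapunov_le_norm_sq[OF m], of "2 * \<mu>" z "x k \<omega>"] \<mu>
        by (simp add: mult.assoc)
      also have "\<mu> * (norm (x k \<omega> - z))\<^sup>2 \<le> (phi f (x k \<omega>) - phi f z) \<bullet> (x k \<omega> - z)"
        by (rule strongly_monotone[OF x_in_profiles[OF \<omega>] zK])
      also have "\<dots> \<le> phi f (x k \<omega>) \<bullet> (x k \<omega> - z)"
      proof -
        have "0 \<le> (x k \<omega> - z) \<bullet> phi f z"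
          using z x_in_profiles[OF \<omega>] by (simp add: VI_solution_def)
        thus ?thesis
          using inner_commute[of "phi f z" "x k \<omega> - z"]
          unfolding inner_diff_left[of "phi f (x k \<omega>)"] by linarith
      qed
      also have "\<dots> = (\<Sum>i\<in>UNIV. ?G i \<omega>)" by (simp add: inner_vec_def)
      finally show ?thesis by simp
    qed
    have "\<theta> * (\<Sum>i\<in>UNIV. P i * (norm (e k \<omega> $ i))\<^sup>2) \<le> \<theta> * Pm * (norm (e k \<omega>))\<^sup>2"
      unfolding mult.assoc using \<theta> by (intro mult_left_mono Es) simp
    moreover have "0 \<le> \<Lambda> * real CARD('i)" using \<Lambda>_nonneg by simp
    ultimately have "\<Lambda> * real CARD('i) * (\<theta> * (\<Sum>i\<in>UNIV. P i * (norm (e k \<omega> $ i))\<^sup>2)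
          + (\<Sum>i\<in>UNIV. ?X i / (\<theta> * P i)))
        \<le> \<Lambda> * real CARD('i) * (\<theta> * Pm * (norm (e k \<omega>))\<^sup>2 + am / \<theta> * ?V k \<omega>)"
      by (intro mult_left_mono add_mono Xs)
    with A Gs show ?thesis unfolding eq by linarith
  qed
  have Ph: "integrable M (\<lambda>\<omega>. P i * ?h i \<omega>)" for i
    by (rule integrable_mult_right) (rule hi)
  have sPh: "integrable M (\<lambda>\<omega>. \<Sum>i\<in>UNIV. P i * ?h i \<omega>)"
    by (rule Bochner_Integration.integrable_sum) (rule Ph)
  have H: "integrable M ?H"
    by (intro Bochner_Integration.integrable_add Bochner_Integration.integrable_diff
        integrable_mult_right integrable_const V E)
  have "expectation (?V (Suc k)) \<le>
      expectation (\<lambda>\<omega>. ?V k \<omega> + (\<Sum>i\<in>{I k \<omega>, J k \<omega>}. ?h i \<omega>))"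
    by (rule integral_mono[OF V Bochner_Integration.integrable_add[OF V active(1)]])
       (rule lyapunov_step[OF z _ \<theta>])
  also have "\<dots> = expectation (?V k) + expectation (\<lambda>\<omega>. \<Sum>i\<in>{I k \<omega>, J k \<omega>}. ?h i \<omega>)"
    by (rule Bochner_Integration.integral_add[OF V active(1)])
  also have "expectation (\<lambda>\<omega>. \<Sum>i\<in>{I k \<omega>, J k \<omega>}. ?h i \<omega>) = (\<Sum>i\<in>UNIV. P i * expectation (?h i))"
    by (rule active(2))
  also have "\<dots> = (\<Sum>i\<in>UNIV. expectation (\<lambda>\<omega>. P i * ?h i \<omega>))"
    by (simp only: integral_mult_right_zero)
  also have "\<dots> = expectation (\<lambda>\<omega>. \<Sum>i\<in>UNIV. P i * ?h i \<omega>)"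
    by (rule Bochner_Integration.integral_sum[symmetric]) (rule Ph)
  also have "\<dots> \<le> expectation ?H"
    by (rule integral_mono[OF sPh H le])
  also have "expectation ?H = real CARD('i) * am * C\<^sup>2 - c * expectation (?V k)
      + \<Lambda> * real CARD('i) * (\<theta> * Pm * expectation (\<lambda>\<omega>. (norm (e k \<omega>))\<^sup>2)
        + am / \<theta> * expectation (?V k))"
    using V[of k] E by (simp add: prob_space)
  finally show ?thesis by (simp add: algebra_simps)
qed

text \<open>For large \<open>k\<close> the mean squared consensus error is below
  \<open>\<sigma>\<^sup>2\<close>; the Lyapunov recursion with this value and a parameter
  \<open>\<theta>\<close> tuned to the level \<open>V'\<close> then has its fixed point below
  \<open>V'\<close>.\<close>

lemma eventually_lyapunov_less:
  assumes z: "VI_solution (profiles K) (phi f) z"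
    and Pm: "\<And>i. P i \<le> Pm" and am: "\<And>i. \<alpha> i \<le> am"
    and m: "\<And>i. m \<le> P i * \<alpha> i" "m \<ge> 0" and c: "c \<le> 2 * \<mu> * m" "c \<le> 1" and \<mu>: "\<mu> \<ge> 0"
    and \<sigma>: "sqrt 2 * (am * C) / (1 - sqrt lam) < \<sigma>" and V': "V' > 0"
    and bound: "real CARD('i) * am * C\<^sup>2 + 2 * \<Lambda> * real CARD('i) * sqrt (am * Pm) * \<sigma> * sqrt V' < c * V'"
  shows "eventually (\<lambda>k. expectation (\<lambda>\<omega>. lyapunov z (x k \<omega>)) < V') sequentially"
proof -
  have r: "0 < sqrt lam" "sqrt lam < 1" using lam by (auto simp: real_sqrt_lt_1_iff)
  have pos: "am > 0" "Pm > 0"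
    using am[of undefined] stepsizes[of undefined] Pm[of undefined] P_pos[of undefined] by linarith+
  have \<sigma>0: "\<sigma> > 0"
    by (rule le_less_trans[OF _ \<sigma>]) (use r pos C_nonneg in auto)
  have a: "\<alpha> i * C \<le> am * C" for i
    using am[of i] C_nonneg by (rule mult_right_mono)
  \<comment> \<open>The consensus recursion has fixed point
    \<open>2 * (am * C)\<^sup>2 / (1 - sqrt lam)\<^sup>2\<close>, whose square root is the lower
    bound imposed on \<open>\<sigma>\<close>.\<close>
  have ev: "eventually (\<lambda>k. expectation (\<lambda>\<omega>. (norm (e k \<omega>))\<^sup>2) < \<sigma>\<^sup>2) sequentially"
  proof (rule linear_recursion_eventually_less[of "sqrt lam"])
    have "sqrt 2 * (am * C) < (1 - sqrt lam) * \<sigma>" using \<sigma> r by (simp add: field_simps)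
    hence "(sqrt 2 * (am * C))\<^sup>2 < ((1 - sqrt lam) * \<sigma>)\<^sup>2"
      using pos C_nonneg by (intro power_strict_mono) auto
    thus "2 * (am * C)\<^sup>2 / (1 - sqrt lam) < (1 - sqrt lam) * \<sigma>\<^sup>2"
      using r by (simp add: power_mult_distrib power2_eq_square field_simps)
  qed (use r deviation_recursion[OF a] in auto)
  \<comment> \<open>This value balances \<open>am * V' / \<theta>\<close> against
    \<open>\<theta> * Pm * \<sigma>\<^sup>2\<close>; both become
    \<open>sqrt (am * Pm) * \<sigma> * sqrt V'\<close>.\<close>
  define \<theta> where "\<theta> = sqrt (am * V') / (sqrt Pm * \<sigma>)"
  have \<theta>: "\<theta> > 0" using pos V' \<sigma>0 by (simp add: \<theta>_def)
  define R where "R = \<Lambda> * real CARD('i) * sqrt (am * Pm) * \<sigma>"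
  have R: "R \<ge> 0" using \<Lambda>_nonneg pos \<sigma>0 by (simp add: R_def)
  have R1: "\<Lambda> * real CARD('i) * (am / \<theta>) = R / sqrt V'"
  proof -
    have "am / \<theta> = (am / sqrt am) * sqrt Pm * \<sigma> / sqrt V'"
      by (simp add: \<theta>_def real_sqrt_mult)
    thus ?thesis using pos by (simp add: R_def real_sqrt_mult real_div_sqrt)
  qed
  have R2: "\<Lambda> * real CARD('i) * (\<theta> * Pm * \<sigma>\<^sup>2) = R * sqrt V'"
  proof -
    have "\<theta> * Pm * \<sigma>\<^sup>2 = sqrt am * sqrt V' * (Pm / sqrt Pm) * \<sigma>"
      using \<sigma>0 by (simp add: \<theta>_def real_sqrt_mult power2_eq_square)
    thus ?thesis using pos by (simp add: R_def real_sqrt_mult real_div_sqrt)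
  qed
  let ?\<rho> = "1 - c + R / sqrt V'"
  let ?h = "real CARD('i) * am * C\<^sup>2 + R * sqrt V'"
  have RV: "R / sqrt V' * V' = R * sqrt V'"
    using V' real_div_sqrt[of V'] by (simp add: field_simps)
  have b: "real CARD('i) * am * C\<^sup>2 + 2 * (R * sqrt V') < c * V'"
    using bound by (simp add: R_def mult_ac)
  from ev have "eventually (\<lambda>k. expectation (\<lambda>\<omega>. lyapunov z (x (Suc k) \<omega>))
      \<le> ?\<rho> * expectation (\<lambda>\<omega>. lyapunov z (x k \<omega>)) + ?h) sequentially"
  proof eventually_elim
    case (elim k)
    have "\<Lambda> * real CARD('i) * (\<theta> * Pm * expectation (\<lambda>\<omega>. (norm (e k \<omega>))\<^sup>2)) \<le> R * sqrt V'"
      unfolding R2[symmetric] using elim \<Lambda>_nonneg \<theta> pos by (intro mult_left_mono) auto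
    with lyapunov_recursion[OF z \<theta> Pm am m c(1) \<mu>, of k] show ?case unfolding R1 by linarith
  qed
  thus ?thesis
  proof (rule linear_recursion_eventually_less[rotated 2])
    \<comment> \<open>The two copies of \<open>R * sqrt V'\<close> in the bound have different
      origins: one comes from the rate \<open>?\<rho>\<close> at level \<open>V'\<close>, the other
      from the constant term \<open>?h\<close>. The condition \<open>c \<le> 1\<close> keeps the
      rate nonnegative.\<close>
    show "0 \<le> ?\<rho>" using c R V' by simp
    have "R / sqrt V' * V' < c * V'"
    proof -
      have "0 \<le> R * sqrt V'" "0 \<le> real CARD('i) * am * C\<^sup>2" using R V' pos by simp_all
      thus ?thesis unfolding RV using b by linarith
    qed
    hence "R / sqrt V' < c" using V' by (simp only: mult_less_cancel_right_pos)
    thus "?\<rho> < 1" by simp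
    show "?h < (1 - ?\<rho>) * V'" using b RV by (simp add: algebra_simps)
  qed
qed

text \<open>If \<open>T\<close> is at least \<open>N * d\<^sup>2\<close>, with \<open>N\<close> the
  number of players, the diameter bound suffices. Otherwise every level \<open>t\<close> between
  \<open>T\<close> and \<open>N * d\<^sup>2\<close> is reached, and \<open>t < N * d\<^sup>2\<close>
  turns the square root of the level in the Lyapunov condition into a constant.\<close>

lemma limsup_norm_sq_le:
  assumes z: "VI_solution (profiles K) (phi f) z"
    and Pm: "\<And>i. P i \<le> Pm" and am: "\<And>i. \<alpha> i \<le> am"
    and m: "\<And>i. m \<le> P i * \<alpha> i" "m \<ge> 0" and c: "0 < c" "c \<le> 2 * \<mu> * m" "c \<le> 1" and \<mu>: "\<mu> \<ge> 0"
    and d: "\<And>i a b. a \<in> K i \<Longrightarrow> b \<in> K i \<Longrightarrow> norm (a - b) \<le> d"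
    and T: "Pm * am * (real CARD('i) * am * C\<^sup>2
      + 2 * \<Lambda> * real CARD('i) * d * am * C * sqrt (2 * real CARD('i)) / (1 - sqrt lam)) \<le> c * T"
  shows "limsup (\<lambda>k. ereal (expectation (\<lambda>\<omega>. (norm (x k \<omega> - z))\<^sup>2))) \<le> ereal T"
proof -
  have r: "0 < sqrt lam" "sqrt lam < 1" using lam by (auto simp: real_sqrt_lt_1_iff)
  have pos: "am > 0" "Pm > 0"
    using am[of undefined] stepsizes[of undefined] Pm[of undefined] P_pos[of undefined] by linarith+
  have zK: "z \<in> profiles K" using z by (simp add: VI_solution_def)
  have d0: "d \<ge> 0" using d[OF profiles_component[OF zK] profiles_component[OF zK]] by simp
  have T0: "T \<ge> 0"
  proof -
    have "0 \<le> Pm * am * (real CARD('i) * am * C\<^sup>2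
      + 2 * \<Lambda> * real CARD('i) * d * am * C * sqrt (2 * real CARD('i)) / (1 - sqrt lam))"
      using pos d0 \<Lambda>_nonneg C_nonneg r by (intro mult_nonneg_nonneg add_nonneg_nonneg divide_nonneg_pos) auto
    hence "0 \<le> c * T" using T by linarith
    thus ?thesis using c by (simp add: zero_le_mult_iff)
  qed
  have X: "integrable M (\<lambda>\<omega>. (norm (x k \<omega> - z))\<^sup>2)" for k
    by (rule integrable_continuous_x) (intro continuous_intros)
  have V: "integrable M (\<lambda>\<omega>. lyapunov z (x k \<omega>))" for k
    by (rule integrable_continuous_x[OF continuous_on_lyapunov])
  show ?thesis
  proof (cases "real CARD('i) * d\<^sup>2 \<le> T")
    case True
    have "expectation (\<lambda>\<omega>. (norm (x k \<omega> - z))\<^sup>2) \<le> expectation (\<lambda>\<omega>. T)" for k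
    proof (rule integral_mono[OF X integrable_const])
      fix \<omega> assume \<omega>: "\<omega> \<in> space M"
      have "(norm (x k \<omega> - z))\<^sup>2 \<le> (\<Sum>i\<in>(UNIV :: 'i set). d\<^sup>2)"
        unfolding norm_sq_vec[of "x k \<omega> - z"]
        using d[OF x_in_K[OF \<omega>] profiles_component[OF zK]] by (intro sum_mono power_mono) auto
      with True show "(norm (x k \<omega> - z))\<^sup>2 \<le> T" by simp
    qed
    thus ?thesis by (intro Limsup_bounded always_eventually) (simp add: prob_space)
  next
    case False
    have *: "limsup (\<lambda>k. ereal (expectation (\<lambda>\<omega>. (norm (x k \<omega> - z))\<^sup>2))) \<le> ereal t"
      if t: "T < t" "t < real CARD('i) * d\<^sup>2" for t
    proof -
      \<comment> \<open>The Lyapunov level that forces the squared distance down to \<open>t\<close>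
        through \<open>norm_sq_le_lyapunov\<close>.\<close>
      define V' where "V' = t / (Pm * am)"
      have t0: "t > 0" using t T0 by linarith
      hence V': "V' > 0" using pos by (simp add: V'_def)
      have tV: "Pm * am * V' = t" using pos by (simp add: V'_def)
      have "d \<noteq> 0" using t t0 by auto
      hence d1: "d > 0" using d0 by simp
      let ?s0 = "sqrt 2 * (am * C) / (1 - sqrt lam)"
      let ?A = "real CARD('i) * am * C\<^sup>2"
      let ?b = "2 * \<Lambda> * real CARD('i) * d * sqrt (real CARD('i))"
      have b0: "?b \<ge> 0" using \<Lambda>_nonneg d0 by simp
      have "Pm * am * (?A + ?b * ?s0) \<le> c * T"
        using T by (simp add: real_sqrt_mult mult_ac)
      also have "\<dots> < Pm * am * (c * V')" using t c tV by (simp add: mult.left_commute[of _ c])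
      finally have lt: "?A + ?b * ?s0 < c * V'" using pos by simp
      obtain \<sigma> where \<sigma>: "?s0 < \<sigma>" "?A + ?b * \<sigma> < c * V'"
      proof
        \<comment> \<open>The strict inequality at \<open>?s0\<close> leaves room to enlarge
          \<open>?s0\<close>; the denominator is \<open>?b + 1\<close> since \<open>?b\<close> may
          vanish.\<close>
        let ?\<delta> = "(c * V' - (?A + ?b * ?s0)) / (?b + 1)"
        have \<delta>: "?\<delta> > 0"
        proof (rule divide_pos_pos)
          show "0 < c * V' - (?A + ?b * ?s0)" using lt by linarith
          show "0 < ?b + 1" using b0 by linarith
        qed
        show "?s0 < ?s0 + ?\<delta>" using \<delta> by simp
        have "?b * ?\<delta> < (?b + 1) * ?\<delta>" using \<delta> by (intro mult_strict_right_mono) auto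
        also have "\<dots> = c * V' - (?A + ?b * ?s0)" using b0 by (simp add: add_nonneg_eq_0_iff)
        finally show "?A + ?b * (?s0 + ?\<delta>) < c * V'" by (simp only: distrib_left)
      qed
      have s0: "?s0 \<ge> 0" using r pos C_nonneg by simp
      \<comment> \<open>The left side is \<open>sqrt t\<close>; this is where
        \<open>t < N * d\<^sup>2\<close> enters.\<close>
      have "sqrt (am * Pm) * sqrt V' \<le> sqrt (real CARD('i)) * d"
      proof -
        have "sqrt (am * Pm) * sqrt V' = sqrt t"
          by (simp only: real_sqrt_mult[symmetric] tV[symmetric] mult.commute[of am])
        also have "\<dots> \<le> sqrt (real CARD('i) * d\<^sup>2)" using t by simp
        finally show ?thesis using d0 by (simp add: real_sqrt_mult)
      qed
      hence "2 * \<Lambda> * real CARD('i) * \<sigma> * (sqrt (am * Pm) * sqrt V')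
          \<le> 2 * \<Lambda> * real CARD('i) * \<sigma> * (sqrt (real CARD('i)) * d)"
        using \<sigma>(1) s0 \<Lambda>_nonneg by (intro mult_left_mono) auto
      hence "?A + 2 * \<Lambda> * real CARD('i) * sqrt (am * Pm) * \<sigma> * sqrt V' < c * V'"
        using \<sigma>(2) by (simp add: mult_ac)
      from eventually_lyapunov_less[OF z Pm am m c(2,3) \<mu> \<sigma>(1) V' this]
      have "eventually (\<lambda>k. ereal (expectation (\<lambda>\<omega>. (norm (x k \<omega> - z))\<^sup>2)) \<le> ereal t) sequentially"
      proof eventually_elim
        case (elim k)
        have "expectation (\<lambda>\<omega>. (norm (x k \<omega> - z))\<^sup>2)
            \<le> expectation (\<lambda>\<omega>. Pm * am * lyapunov z (x k \<omega>))"
          by (intro integral_mono X integrable_mult_right V norm_sq_le_lyapunov Pm am)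
        also have "\<dots> = Pm * am * expectation (\<lambda>\<omega>. lyapunov z (x k \<omega>))" by simp
        also have "\<dots> \<le> Pm * am * V'" using elim pos by (intro mult_left_mono) auto
        finally show ?case by (simp add: tV)
      qed
      thus ?thesis by (rule Limsup_bounded)
    qed
    show ?thesis
    \<comment> \<open>The bound holds for every level strictly between \<open>T\<close> and
      \<open>N * d\<^sup>2\<close>; let it decrease to \<open>T\<close>.\<close>
    proof (rule dense_ge_bounded)
      show "ereal T < ereal (real CARD('i) * d\<^sup>2)" using False by simp
      fix w assume w: "ereal T < w" "w < ereal (real CARD('i) * d\<^sup>2)"
      then obtain t where "w = ereal t" by (cases w) auto
      with w * show "limsup (\<lambda>k. ereal (expectation (\<lambda>\<omega>. (norm (x k \<omega> - z))\<^sup>2))) \<le> w" by simp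
    qed
  qed
qed

end

section \<open>Specialization to the extremal constants of the game\<close>

theorem proposition4:
  fixes K :: "'i::finite \<Rightarrow> (real^'n) set"
    and f :: "'i \<Rightarrow> real^'n \<Rightarrow> real^'n \<Rightarrow> real"
    and U :: "(real^'n) set"
    and \<alpha> L Lbar :: "'i \<Rightarrow> real"
    and \<mu> C lam Mdiam :: real
    and E :: "'i set set"
    and p :: "'i \<Rightarrow> 'i \<Rightarrow> real"
    and M :: "'w measure"
    and I J :: "nat \<Rightarrow> 'w \<Rightarrow> 'i"
    and X0 :: "'w \<Rightarrow> (real^'n)^'i"
  defines "N \<equiv> real CARD('i)"
    and "n \<equiv> real CARD('n)"
    and "p_max \<equiv> Max (range (update_prob E p))"
    and "p_min \<equiv> Min (range (update_prob E p))"
    and "\<alpha>_max \<equiv> Max (range \<alpha>)"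
    and "\<alpha>_min \<equiv> Min (range \<alpha>)"
    and "L_max \<equiv> Max (range L)"
    and "B \<equiv> Max (range Lbar) * real CARD('i) * Mdiam"
    and "x \<equiv> x_seq K f \<alpha> I J X0"
    and "vhat \<equiv> vhat_seq K f \<alpha> I J X0"
    and "y \<equiv> y_seq K f \<alpha> I J X0"
  assumes N_ge_2: "CARD('i) \<ge> 2"
    and stepsizes: "\<And>i. \<alpha> i > 0"
    and graph: "simple_graph E"
    and gossip: "gossip_model M E p I J X0"
    and init: "\<And>\<omega>. \<omega> \<in> space M \<Longrightarrow> X0 \<omega> \<in> profiles K"
    \<comment> \<open>\<open>U\<close> is the domain of the aggregate argument; \<open>U = Kbar K\<close> if the iterates stay there\<close>
    and dom: "Kbar K \<subseteq> U"
    and dom_vhat: "\<And>i k \<omega>. \<omega> \<in> space M \<Longrightarrow> N *\<^sub>R vhat k \<omega> $ i \<in> U"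
    and K_sets: "\<And>i. K i \<noteq> {} \<and> compact (K i) \<and> convex (K i)"
    and f_C1: "\<And>i. \<exists>S. open S \<and> K i \<times> U \<subseteq> S \<and>
                 continuously_differentiable_on (\<lambda>(a, u). f i a u) S"
    and f_convex: "\<And>i z. z \<in> profiles K \<Longrightarrow>
                 convex_on (K i) (\<lambda>a. f i a (a + (\<Sum>j\<in>UNIV - {i}. z $ j)))"
    and strictly_monotone: "\<And>z w. z \<in> profiles K \<Longrightarrow> w \<in> profiles K \<Longrightarrow> z \<noteq> w \<Longrightarrow>
                 (phi f z - phi f w) \<bullet> (z - w) > 0"
    and mu_pos: "\<mu> > 0"
    and strongly_monotone: "\<And>z w. z \<in> profiles K \<Longrightarrow> w \<in> profiles K \<Longrightarrow>
                 (phi f z - phi f w) \<bullet> (z - w) \<ge> \<mu> * (norm (z - w))\<^sup>2"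
    and Lbar_pos: "\<And>i. Lbar i > 0"
    and lipschitz_u: "\<And>i a z1 z2. a \<in> K i \<Longrightarrow> z1 \<in> U \<Longrightarrow> z2 \<in> U \<Longrightarrow>
                 norm (F f i a z1 - F f i a z2) \<le> Lbar i * norm (z1 - z2)"
    and L_pos: "\<And>i. L i > 0"
    and lipschitz_x: "\<And>i a b u. a \<in> K i \<Longrightarrow> b \<in> K i \<Longrightarrow> u \<in> Kbar K \<Longrightarrow>
                 norm (F f i a u - F f i b u) \<le> L i * norm (a - b)"
    and connected: "connected_graph E"
    and step_cond:
      "0 < 1 - 2 * \<mu> * p_min * \<alpha>_min + 2 * p_max * L_max * (\<alpha>_max - \<alpha>_min)"
      "1 - 2 * \<mu> * p_min * \<alpha>_min + 2 * p_max * L_max * (\<alpha>_max - \<alpha>_min) < 1"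
    and Mdiam: "\<And>i a b. a \<in> K i \<Longrightarrow> b \<in> K i \<Longrightarrow> norm (a - b) \<le> Mdiam"
    and C_y: "\<And>i k \<omega>. \<omega> \<in> space M \<Longrightarrow> norm (F f i (x k \<omega> $ i) (N *\<^sub>R y k \<omega>)) \<le> C"
    and C_vhat: "\<And>i k \<omega>. \<omega> \<in> space M \<Longrightarrow>
                 norm (F f i (x k \<omega> $ i) (N *\<^sub>R vhat k \<omega> $ i)) \<le> C"
    and lam: "0 < lam" "lam < 1"
    and lam_bound: "\<And>k z. integral\<^sup>L M (\<lambda>\<omega>.
                 (norm (disagreement_matrix (I k \<omega>) (J k \<omega>) *v z))\<^sup>2) \<le> lam * (norm z)\<^sup>2"
  shows "(\<exists>!xs. VI_solution (profiles K) (phi f) xs) \<and>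
         (\<forall>xs. VI_solution (profiles K) (phi f) xs \<longrightarrow>
            limsup (\<lambda>k. ereal (integral\<^sup>L M (\<lambda>\<omega>. (norm (x k \<omega> - xs))\<^sup>2)))
            \<le> ereal (p_max * \<alpha>_max\<^sup>2 *
                      (2 * C\<^sup>2 * N + B * C * (sqrt (2 * n * N) / (1 - sqrt lam))) /
                     (\<mu> * p_min * \<alpha>_min - p_max * L_max * (\<alpha>_max - \<alpha>_min))))"
proof -
  have finP: "finite (range (update_prob E p))" and fina: "finite (range \<alpha>)"
    and finL: "finite (range L)" and finLb: "finite (range Lbar)" by simp_all
  define \<Lambda> where "\<Lambda> = Max (range Lbar)"
  have Lb: "Lbar i \<le> \<Lambda>" for i unfolding \<Lambda>_def using finLb by (intro Max_ge) auto
  have \<Lambda>0: "\<Lambda> > 0" using Lb[of undefined] Lbar_pos[of undefined] by linarith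
  have F_cont: "continuous_on (K i \<times> U) (\<lambda>(a, u). F f i a u)" for i
    using f_C1[of i] continuous_on_F continuous_on_subset by metis
  have lip: "norm (F f i a z1 - F f i a z2) \<le> \<Lambda> * norm (z1 - z2)"
    if "a \<in> K i" "z1 \<in> U" "z2 \<in> U" for i a z1 z2
    using lipschitz_u[OF that] mult_right_mono[OF Lb[of i] norm_ge_zero[of "z1 - z2"]] by linarith
  have "prob_space M" using gossip by (simp add: gossip_model_def)
  then interpret prob_space M .
  interpret gossip_game M E p I J X0 K f U \<alpha> \<Lambda> C lam \<mu>
    by unfold_locales
      (use graph gossip stepsizes init dom dom_vhat K_sets F_cont strongly_monotone \<Lambda>0 lip C_vhat lam
         lam_bound in \<open>auto simp: N_def x_def vhat_def\<close>)
  have P_le: "update_prob E p i \<le> p_max" and P_ge: "p_min \<le> update_prob E p i" for i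
    unfolding p_max_def p_min_def using finP by (auto intro: Max_ge Min_le)
  have a_le: "\<alpha> i \<le> \<alpha>_max" and a_ge: "\<alpha>_min \<le> \<alpha> i" for i
    unfolding \<alpha>_max_def \<alpha>_min_def using fina by (auto intro: Max_ge Min_le)
  have p_min: "p_min > 0"
    unfolding p_min_def using finP by (subst Min_gr_iff) (auto simp: P_pos)
  have \<alpha>_min: "\<alpha>_min > 0"
    unfolding \<alpha>_min_def using fina by (subst Min_gr_iff) (auto simp: stepsizes)
  have L_max: "L_max > 0"
    unfolding L_max_def using finL by (subst Max_gr_iff) (auto simp: L_pos)
  have p_max: "p_max > 0" and \<alpha>_max: "\<alpha>_max > 0" and \<alpha>_le: "\<alpha>_min \<le> \<alpha>_max"
    using P_le[of undefined] P_ge[of undefined] a_le[of undefined] a_ge[of undefined] p_min \<alpha>_min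
    by linarith+
  \<comment> \<open>The step condition says exactly that \<open>0 < 2 * den < 1\<close>, so
    \<open>2 * den\<close> can serve as the contraction constant \<open>c\<close>.\<close>
  define den where "den = \<mu> * p_min * \<alpha>_min - p_max * L_max * (\<alpha>_max - \<alpha>_min)"
  have den: "0 < den" "2 * den \<le> 1" using step_cond by (auto simp: den_def algebra_simps)
  have "0 \<le> p_max * L_max * (\<alpha>_max - \<alpha>_min)" using p_max L_max \<alpha>_le by simp
  \<comment> \<open>With \<open>m = p_min * \<alpha>_min\<close>, the contraction
    \<open>2 * \<mu> * m\<close> of the weighted function exceeds \<open>2 * den\<close> by the
    nonnegative stepsize-heterogeneity term.\<close>
  hence c_le: "2 * den \<le> 2 * \<mu> * (p_min * \<alpha>_min)" by (simp add: den_def)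
  have m_le: "p_min * \<alpha>_min \<le> update_prob E p i * \<alpha> i" for i
    using P_ge[of i] a_ge[of i] p_min \<alpha>_min by (intro mult_mono) auto
  let ?T = "p_max * \<alpha>_max\<^sup>2 * (2 * C\<^sup>2 * N + B * C * (sqrt (2 * n * N) / (1 - sqrt lam))) / den"
  have r: "sqrt lam < 1" using lam by (simp add: real_sqrt_lt_1_iff)
  obtain a0 i0 where "a0 \<in> K i0" using K_sets by blast
  hence Md0: "Mdiam \<ge> 0" using Mdiam[of a0 i0 a0] by simp
  have n1: "n \<ge> 1" by (simp add: n_def Suc_le_eq)
  have BC: "B * C \<ge> 0" using \<Lambda>0 Md0 C_nonneg by (simp add: B_def \<Lambda>_def[symmetric])
  \<comment> \<open>After multiplication by \<open>2 * den\<close> the target offers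
    \<open>4 * (C\<^sup>2 * N)\<close> where \<open>C\<^sup>2 * N\<close> is required, and
    \<open>sqrt (2 * n * N)\<close> where \<open>sqrt (2 * N)\<close> is.\<close>
  have T_bound: "p_max * \<alpha>_max * (real CARD('i) * \<alpha>_max * C\<^sup>2 + 2 * \<Lambda> * real CARD('i) * Mdiam * \<alpha>_max * C *
      sqrt (2 * real CARD('i)) / (1 - sqrt lam)) \<le> (2 * den) * ?T"
  proof -
    have "p_max * \<alpha>_max * (real CARD('i) * \<alpha>_max * C\<^sup>2 + 2 * \<Lambda> * real CARD('i) * Mdiam * \<alpha>_max * C *
      sqrt (2 * real CARD('i)) / (1 - sqrt lam)) =
      p_max * \<alpha>_max\<^sup>2 * (C\<^sup>2 * N + 2 * (B * C * (sqrt (2 * N) / (1 - sqrt lam))))"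
      by (simp add: B_def N_def \<Lambda>_def power2_eq_square algebra_simps)
    also have "\<dots> \<le> p_max * \<alpha>_max\<^sup>2 *
        (4 * (C\<^sup>2 * N) + 2 * (B * C * (sqrt (2 * n * N) / (1 - sqrt lam))))"
    proof (intro mult_left_mono add_mono divide_right_mono)
      show "C\<^sup>2 * N \<le> 4 * (C\<^sup>2 * N)" by (simp add: N_def)
      show "sqrt (2 * N) \<le> sqrt (2 * n * N)" using n1 by (simp add: N_def)
    qed (use BC r p_max in auto)
    also have "\<dots> = 2 * (p_max * \<alpha>_max\<^sup>2 *
        (2 * C\<^sup>2 * N + B * C * (sqrt (2 * n * N) / (1 - sqrt lam))))"
      by (simp add: algebra_simps)
    also have "2 * b = (2 * den) * (b / den)" for b :: real using den by simp
    finally show ?thesis .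
  qed
  have "\<exists>z. VI_solution (profiles K) (phi f) z"
    using K_sets by (intro VI_solution_exists compact_profiles convex_profiles profiles_nonempty
        phi_continuous) auto
  moreover have "z = w"
    if z: "VI_solution (profiles K) (phi f) z" and w: "VI_solution (profiles K) (phi f) w" for z w
  \<comment> \<open>Adding the variational inequalities of \<open>z\<close> and \<open>w\<close>,
    each tested at the other, contradicts strict monotonicity.\<close>
  proof (rule ccontr)
    assume "z \<noteq> w"
    have zw: "z \<in> profiles K" "w \<in> profiles K" using z w by (auto simp: VI_solution_def)
    have "0 \<le> (w - z) \<bullet> phi f z" "0 \<le> (z - w) \<bullet> phi f w"
      using z w zw by (auto simp: VI_solution_def)
    hence "(phi f z - phi f w) \<bullet> (z - w) \<le> 0"
      by (simp add: inner_diff_left inner_diff_right inner_commute)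
    with strictly_monotone[OF zw \<open>z \<noteq> w\<close>] show False by simp
  qed
  ultimately have "\<exists>!xs. VI_solution (profiles K) (phi f) xs" by blast
  moreover have "limsup (\<lambda>k. ereal (integral\<^sup>L M (\<lambda>\<omega>. (norm (x k \<omega> - xs))\<^sup>2))) \<le> ereal ?T"
    if "VI_solution (profiles K) (phi f) xs" for xs
    unfolding x_def
    by (rule limsup_norm_sq_le[OF that P_le a_le m_le _ _ c_le den(2) _ Mdiam T_bound])
       (use p_min \<alpha>_min den mu_pos in auto)
  ultimately show ?thesis unfolding den_def by blast
qed

end
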